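(* Let $\mathbb{K}$ be a field, $V$ a two-dimensional $\mathbb{K}$-vector space, and $\mathcal{A}$ a finite set of distinct one-dimensional linear subspaces of $V$. Let $C$ be a finite maximal connected component of $\Lambda'$ and let $\mu\in C$ satisfy $\Delta(\mu)=\max\{\Delta(\nu)\mid\nu\in C\}$. Then $C=B(\mu,\Delta(\mu))$, and for every $\nu\in C$ we have $\Delta(\nu)=\Delta(\mu)-d(\mu,\nu)$. In particular, the set of elements of $C$ at which $\Delta|_C$ attains its maximum consists of exactly one point.
   Context: Let $S=\mathrm{Sym}(V^* )\cong\mathbb{K}[x,y]$, graded by polynomial degree; for $H\in\mathcal{A}$ fix $\alpha_H\in V^*$ with $\ker\alpha_H=H$. Let $\Lambda=\mathbb{N}^{|\mathcal{A}|}$, whose elements are multiplicities $\mu:\mathcal{A}\to\mathbb{N}$, $H\mapsto\mu_H$. For $\mu\in\Lambda$, $D(\mathcal{A},\mu)=\{\delta\in S\partial_x\oplus S\partial_y\mid \delta(\alpha_H)\in\alpha_H^{\mu_H}S\ \forall H\}$ is a free graded $S$-module of rank 2; if $(d_1,d_2)$ are the degrees of a homogeneous basis, $\Delta(\mu)=|d_1-d_2|$. Order $\Lambda$ componentwise, $|\mu|=\sum_H\mu_H$, $\mu\mathrel{\dot\subset}\nu$ means $\mu\subset\nu$ and $|\nu|=|\mu|+1$; the Hasse graph has edges $\{\mu,\nu\}$ with $\mu\mathrel{\dot\subset}\nu$, and connectivity of subsets of $\Lambda$ refers to the induced subgraph. $\Lambda'=\Delta^{-1}(\mathbb{Z}_{>0})$.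 The distance is $d(\mu,\nu)=\sum_H|\mu_H-\nu_H|$, and the ball is $B(\mu,r)=\{\nu\in\Lambda\mid d(\mu,\nu)<r\}$. *)

theory Defs
  imports
    "HOL-Computational_Algebra.Polynomial"
    "HOL-Library.Product_Plus"
    "HOL-Library.FuncSet"
begin

text \<open>
  The ring \<open>S = K[x,y]\<close> is represented by the type \<open>'k poly poly\<close>: the outer variable is \<open>y\<close>,
  the inner one is \<open>x\<close>, so the coefficient of \<open>x\<^sup>i y\<^sup>j\<close> in \<open>p\<close> is \<open>coeff (coeff p j) i\<close>.
\<close>

definition varX :: "'k::field poly poly" where
  "varX = [:[:0, 1:]:]"

definition varY :: "'k::field poly poly" where
  "varY = [:0, 1:]"

definition dX :: "'k::field poly poly \<Rightarrow> 'k poly poly" where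
  "dX p = map_poly pderiv p"

definition dY :: "'k::field poly poly \<Rightarrow> 'k poly poly" where
  "dY p = pderiv p"

definition homogeneous_poly :: "nat \<Rightarrow> 'k::field poly poly \<Rightarrow> bool" where
  "homogeneous_poly d p \<longleftrightarrow> (\<forall>i j. coeff (coeff p j) i \<noteq> 0 \<longrightarrow> i + j = d)"

text \<open>
  If \<open>x, y\<close> is the basis of the dual space that is dual to a basis \<open>e1, e2\<close> of \<open>V\<close>, then a linear
  form \<open>f\<close> on \<open>V\<close> equals \<open>f e1 * x + f e2 * y\<close>; this is the inclusion of the dual space in \<open>S\<close>.
\<close>

definition linear_form_poly :: "'v \<Rightarrow> 'v \<Rightarrow> ('v \<Rightarrow> 'k::field) \<Rightarrow> 'k poly poly" where
  "linear_form_poly e1 e2 f = smult [:f e1:] varX + smult [:f e2:] varY"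

text \<open>The pair \<open>(f, g)\<close> stands for the derivation \<open>f \<partial>\<^sub>x + g \<partial>\<^sub>y\<close>.\<close>

type_synonym 'k derivation = "'k poly poly \<times> 'k poly poly"

definition der_apply :: "'k::field derivation \<Rightarrow> 'k poly poly \<Rightarrow> 'k poly poly" where
  "der_apply \<delta> p = fst \<delta> * dX p + snd \<delta> * dY p"

definition der_scale :: "'k::field poly poly \<Rightarrow> 'k derivation \<Rightarrow> 'k derivation" where
  "der_scale p \<delta> = (p * fst \<delta>, p * snd \<delta>)"

lemma module_der_scale: "module der_scale"
  by unfold_locales (auto simp: der_scale_def algebra_simps prod_eq_iff)

definition homogeneous_der :: "nat \<Rightarrow> 'k::field derivation \<Rightarrow> bool" where
  "homogeneous_der d \<delta> \<longleftrightarrow> homogeneous_poly d (fst \<delta>) \<and> homogeneous_poly d (snd \<delta>)"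

text \<open>
  In the following, \<open>A\<close> is the arrangement and \<open>a H\<close> is the linear form, viewed in \<open>S\<close>, that
  defines \<open>H\<close>.  Multiplicities are extensional functions on \<open>A\<close>, so that two of them are equal
  as soon as they agree on \<open>A\<close>.
\<close>

definition multiplicities :: "'h set \<Rightarrow> ('h \<Rightarrow> nat) set" where
  "multiplicities A = A \<rightarrow>\<^sub>E UNIV"

definition log_derivations ::
    "'h set \<Rightarrow> ('h \<Rightarrow> 'k::field poly poly) \<Rightarrow> ('h \<Rightarrow> nat) \<Rightarrow> 'k derivation set" where
  "log_derivations A a \<mu> = {\<delta>. \<forall>H\<in>A. a H ^ \<mu> H dvd der_apply \<delta> (a H)}"

definition basis_degrees ::
    "'h set \<Rightarrow> ('h \<Rightarrow> 'k::field poly poly) \<Rightarrow> ('h \<Rightarrow> nat) \<Rightarrow> nat \<Rightarrow> nat \<Rightarrow> bool" where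
  "basis_degrees A a \<mu> d1 d2 \<longleftrightarrow>
    (\<exists>\<theta>1 \<theta>2. \<theta>1 \<noteq> \<theta>2 \<and> homogeneous_der d1 \<theta>1 \<and> homogeneous_der d2 \<theta>2 \<and>
      \<not> module.dependent der_scale {\<theta>1, \<theta>2} \<and>
      module.span der_scale {\<theta>1, \<theta>2} = log_derivations A a \<mu>)"

definition Delta :: "'h set \<Rightarrow> ('h \<Rightarrow> 'k::field poly poly) \<Rightarrow> ('h \<Rightarrow> nat) \<Rightarrow> nat" where
  "Delta A a \<mu> =
    (THE n. \<exists>d1 d2. basis_degrees A a \<mu> d1 d2 \<and> int n = \<bar>int d1 - int d2\<bar>)"

definition Lambda' :: "'h set \<Rightarrow> ('h \<Rightarrow> 'k::field poly poly) \<Rightarrow> ('h \<Rightarrow> nat) set" where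
  "Lambda' A a = {\<mu> \<in> multiplicities A. Delta A a \<mu> > 0}"

definition mult_size :: "'h set \<Rightarrow> ('h \<Rightarrow> nat) \<Rightarrow> nat" where
  "mult_size A \<mu> = (\<Sum>H\<in>A. \<mu> H)"

definition covered :: "'h set \<Rightarrow> ('h \<Rightarrow> nat) \<Rightarrow> ('h \<Rightarrow> nat) \<Rightarrow> bool" where
  "covered A \<mu> \<nu> \<longleftrightarrow> (\<forall>H\<in>A. \<mu> H \<le> \<nu> H) \<and> mult_size A \<nu> = mult_size A \<mu> + 1"

definition induced_edges :: "'h set \<Rightarrow> ('h \<Rightarrow> nat) set \<Rightarrow> (('h \<Rightarrow> nat) \<times> ('h \<Rightarrow> nat)) set" where
  "induced_edges A C = {(\<mu>, \<nu>). \<mu> \<in> C \<and> \<nu> \<in> C \<and> (covered A \<mu> \<nu> \<or> covered A \<nu> \<mu>)}"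

definition connected_subset :: "'h set \<Rightarrow> ('h \<Rightarrow> nat) set \<Rightarrow> bool" where
  "connected_subset A C \<longleftrightarrow>
    C \<noteq> {} \<and> C \<subseteq> multiplicities A \<and> (\<forall>\<mu>\<in>C. \<forall>\<nu>\<in>C. (\<mu>, \<nu>) \<in> (induced_edges A C)\<^sup>*)"

definition connected_component_of_subset ::
    "'h set \<Rightarrow> ('h \<Rightarrow> nat) set \<Rightarrow> ('h \<Rightarrow> nat) set \<Rightarrow> bool" where
  "connected_component_of_subset A L C \<longleftrightarrow>
    connected_subset A C \<and> C \<subseteq> L \<and>
    (\<forall>C'. connected_subset A C' \<and> C \<subseteq> C' \<and> C' \<subseteq> L \<longrightarrow> C' = C)"

definition mult_dist :: "'h set \<Rightarrow> ('h \<Rightarrow> nat) \<Rightarrow> ('h \<Rightarrow> nat) \<Rightarrow> nat" where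
  "mult_dist A \<mu> \<nu> = (\<Sum>H\<in>A. nat \<bar>int (\<mu> H) - int (\<nu> H)\<bar>)"

definition mult_ball :: "'h set \<Rightarrow> ('h \<Rightarrow> nat) \<Rightarrow> nat \<Rightarrow> ('h \<Rightarrow> nat) set" where
  "mult_ball A \<mu> r = {\<nu> \<in> multiplicities A. mult_dist A \<mu> \<nu> < r}"

end

(*
  Let mu maximise Delta on C and let theta be the basis element of D(mu) of smaller degree d.
  Comparing mu with its neighbours shows that theta is sharp (theta(alpha_H) is not divisible by
  alpha_H^(mu_H + 1)) and primitive (theta = g tau forces g to be a unit).  For a multiplicity nu
  put f = prod alpha_H^(nu_H - mu_H), the product over those H with nu_H > mu_H.  Then f theta
  lies in D(nu), which gives Delta(nu) >= Delta(mu) - d(mu,nu).  If Delta(nu) > 0 and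
  d(mu,nu) <= Delta(mu), then f theta has smaller degree than the second basis element of D(nu),
  so f theta = g tau for the first one; sharpness makes g prime to f, and then primitivity makes
  g a unit, so equality holds.  Thus the open ball of radius Delta(mu) lies in Lambda', and
  Delta vanishes on the sphere around it.
*)

theory Submission
  imports Defs
begin

text \<open>\<open>Delta\<close> is a definite description, so nothing can be said about it before
  D(\<mu>) is known to have a homogeneous basis with degrees independent of its choice. The field is
  arbitrary, and the basis is built by raising one multiplicity by one: one generator is corrected
  so that it survives, the other is multiplied by the form. This also yields d1 + d2 = |\<mu>|,
  hence Delta(\<mu>) = |\<mu>| - 2 d1 for the smaller degree d1. Every later comparison rests on one
  consequence: a nonzero homogeneous element of degree e in D(\<nu>) forces Delta(\<nu>) >= |\<nu>|
  - 2 e. Neighbours of \<mu> can only forbid a g divisible by some alpha_H. If g is prime to all the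
  forms, tau already lies in D(\<mu>), and independence of the basis makes g invertible. The
  equality is proved up to and including d(\<mu>,\<nu>) = Delta(\<mu>) because a path leaving the
  open ball has to meet that sphere, where the equality contradicts Delta(\<nu>) > 0.\<close>

section \<open>Homogeneous polynomials in two variables and their graded parts\<close>

lemma homogeneous_poly_0 [simp]: "homogeneous_poly d 0"
  by (simp add: homogeneous_poly_def)

lemma homogeneous_poly_const: "homogeneous_poly 0 [:[:e:]:]"
  by (auto simp: homogeneous_poly_def coeff_pCons split: nat.splits)

lemma homogeneous_poly_1: "homogeneous_poly 0 1"
  using homogeneous_poly_const[of 1] by (simp add: one_pCons)

lemma homogeneous_poly_add:
  "homogeneous_poly d p \<Longrightarrow> homogeneous_poly d q \<Longrightarrow> homogeneous_poly d (p + q)"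
  unfolding homogeneous_poly_def by (metis add_0 coeff_add)

lemma homogeneous_poly_diff:
  "homogeneous_poly d p \<Longrightarrow> homogeneous_poly d q \<Longrightarrow> homogeneous_poly d (p - q)"
  unfolding homogeneous_poly_def by (metis diff_self coeff_diff)

lemma coeff_coeff_mult:
  fixes p q :: "'k::field poly poly"
  shows "coeff (coeff (p * q) j) i =
    (\<Sum>j'\<le>j. \<Sum>i'\<le>i. coeff (coeff p j') i' * coeff (coeff q (j - j')) (i - i'))"
  by (simp add: coeff_mult coeff_sum)

lemma homogeneous_poly_mult:
  assumes "homogeneous_poly d p" "homogeneous_poly e q"
  shows "homogeneous_poly (d + e) (p * q)"
  unfolding homogeneous_poly_def
proof (intro allI impI)
  fix i j
  assume "coeff (coeff (p * q) j) i \<noteq> 0"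
  then obtain j' i' where "j' \<le> j" "i' \<le> i"
    "coeff (coeff p j') i' * coeff (coeff q (j - j')) (i - i') \<noteq> 0"
    unfolding coeff_coeff_mult by (metis (no_types, lifting) atMost_iff sum.neutral)
  then have "i' + j' = d" "(i - i') + (j - j') = e" "j' \<le> j" "i' \<le> i"
    using assms by (auto simp: homogeneous_poly_def)
  then show "i + j = d + e"
    by linarith
qed

lemma homogeneous_poly_power:
  "homogeneous_poly d p \<Longrightarrow> homogeneous_poly (d * n) (p ^ n)"
  by (induction n) (auto simp: homogeneous_poly_1 dest: homogeneous_poly_mult)

lemma homogeneous_poly_prod:
  assumes "finite B" "\<And>H. H \<in> B \<Longrightarrow> homogeneous_poly (d H) (f H)"
  shows "homogeneous_poly (\<Sum>H\<in>B. d H) (\<Prod>H\<in>B. f H)"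
  using assms
  by (induction B rule: finite_induct) (auto simp: homogeneous_poly_1 intro!: homogeneous_poly_mult)

definition homogeneous_part :: "nat \<Rightarrow> 'k::field poly poly \<Rightarrow> 'k poly poly" where
  "homogeneous_part n p = (\<Sum>j\<le>n. monom (monom (coeff (coeff p j) (n - j)) (n - j)) j)"

lemma coeff_homogeneous_part:
  "coeff (coeff (homogeneous_part n p) j) i = (if i + j = n then coeff (coeff p j) i else 0)"
proof -
  have "coeff (coeff (homogeneous_part n p) j) i =
      (\<Sum>j'\<le>n. if j' = j then (if n - j' = i then coeff (coeff p j') (n - j') else 0) else 0)"
    unfolding homogeneous_part_def coeff_sum by (intro sum.cong) auto
  also have "\<dots> = (if i + j = n then coeff (coeff p j) i else 0)"
    by (subst sum.delta) auto
  finally show ?thesis .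
qed

lemma homogeneous_homogeneous_part: "homogeneous_poly n (homogeneous_part n p)"
  by (simp add: homogeneous_poly_def coeff_homogeneous_part)

lemma homogeneous_part_add:
  "homogeneous_part n (p + q) = homogeneous_part n p + homogeneous_part n q"
  by (intro poly_eqI) (simp add: coeff_homogeneous_part)

lemma homogeneous_part_same: "homogeneous_poly n p \<Longrightarrow> homogeneous_part n p = p"
  by (intro poly_eqI) (auto simp: coeff_homogeneous_part homogeneous_poly_def)

text \<open>Only index pairs with \<open>i' + j' = e\<close> contribute to the convolution, so total
  degree \<open>n\<close> in the product selects degree \<open>n - e\<close> in \<open>q\<close>.
  The case distinction guards the truncated subtraction.\<close>

lemma homogeneous_part_mult:
  assumes "homogeneous_poly e p"
  shows "homogeneous_part n (p * q) = (if e \<le> n then p * homogeneous_part (n - e) q else 0)"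
proof (intro poly_eqI)
  fix j i
  have p0: "coeff (coeff p j') i' = 0" if "i' + j' \<noteq> e" for i' j'
    using assms that by (auto simp: homogeneous_poly_def)
  have e0: "coeff (coeff p j') i' = 0" if "\<not> e \<le> i + j" "i' \<le> i" "j' \<le> j" for i' j'
    using that by (intro p0) auto
  have *: "coeff (coeff (p * homogeneous_part (n - e) q) j) i =
      (if i + j = n then coeff (coeff (p * q) j) i else 0)" if "e \<le> n"
  proof -
    have "coeff (coeff p j') i' * coeff (coeff (homogeneous_part (n - e) q) (j - j')) (i - i') =
        (if i + j = n then coeff (coeff p j') i' * coeff (coeff q (j - j')) (i - i') else 0)"
      if "j' \<le> j" "i' \<le> i" for j' i'
      using that \<open>e \<le> n\<close> p0[of i' j'] 
      by (cases "i' + j' = e") (auto simp: coeff_homogeneous_part)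
    then show ?thesis
      unfolding coeff_coeff_mult by simp
  qed
  show "coeff (coeff (homogeneous_part n (p * q)) j) i =
      coeff (coeff (if e \<le> n then p * homogeneous_part (n - e) q else 0) j) i"
  proof (cases "e \<le> n")
    case False
    have "coeff (coeff (p * q) j) i = 0" if "i + j = n"
      unfolding coeff_coeff_mult using e0 that False by (auto intro!: sum.neutral)
    then show ?thesis
      using False by (simp add: coeff_homogeneous_part)
  qed (simp add: * coeff_homogeneous_part)
qed

text \<open>Taking parts of degree \<open>n\<close> turns \<open>p * q\<close> into \<open>p\<close>
  times one graded part of \<open>q\<close>, and \<open>p\<close> cancels in the domain S. For
  \<open>n < e\<close> that part would be zero, although the product is not.\<close>

lemma homogeneous_poly_factor:
  assumes "homogeneous_poly e p" "p \<noteq> 0" "homogeneous_poly n (p * q)" "q \<noteq> 0"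
  shows "e \<le> n" "homogeneous_poly (n - e) q"
proof -
  have *: "p * q = (if e \<le> n then p * homogeneous_part (n - e) q else 0)"
    using homogeneous_part_mult[OF assms(1), of n q] homogeneous_part_same[OF assms(3)] by simp
  then show "e \<le> n"
    using assms(2,4) by (auto split: if_splits)
  with * have "q = homogeneous_part (n - e) q"
    using assms(2) by auto
  then show "homogeneous_poly (n - e) q"
    by (metis homogeneous_homogeneous_part)
qed

text \<open>If \<open>e\<close> were positive, the part of degree 0 of \<open>g * h\<close> would
  vanish, whereas that of 1 is 1.\<close>

lemma homogeneous_poly_is_unit:
  assumes "homogeneous_poly e g" "g dvd 1"
  shows "e = 0"
proof -
  obtain h where "1 = g * h"
    using assms(2) by (elim dvdE)
  then have "(1 :: 'a poly poly) = (if e \<le> 0 then g * homogeneous_part (0 - e) h else 0)"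
    using homogeneous_part_mult[OF assms(1), of 0 h] homogeneous_part_same[OF homogeneous_poly_1]
    by metis
  then show ?thesis
    by (auto split: if_splits)
qed

section \<open>Linear forms and divisibility by them\<close>

text \<open>This is the form b x + c y, with \<open>x\<close> as the inner variable and
  \<open>y\<close> as the outer one.\<close>

definition linear_poly :: "'k::field \<Rightarrow> 'k \<Rightarrow> 'k poly poly" where
  "linear_poly b c = [:[:0, b:], [:c:]:]"

lemma homogeneous_linear_poly: "homogeneous_poly 1 (linear_poly b c)"
  by (auto simp: homogeneous_poly_def linear_poly_def coeff_pCons split: nat.splits)

lemma linear_poly_eq_0_iff: "linear_poly b c = 0 \<longleftrightarrow> b = 0 \<and> c = 0"
  by (auto simp: linear_poly_def)

text \<open>Restriction to the line on which the linear form vanishes.\<close>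

lemma linear_poly_restriction:
  fixes b c :: "'k::field"
  assumes "b \<noteq> 0 \<or> c \<noteq> 0"
  obtains E :: "'k poly poly \<Rightarrow> 'k poly" and l where
    "\<And>p q. E (p - q) = E p - E q" "\<And>p q. E (p * q) = E p * E q"
    "\<And>p. E p = 0 \<longleftrightarrow> linear_poly b c dvd p"
    "\<And>k p. homogeneous_poly k p \<Longrightarrow> \<exists>e. E p = monom e k"
    "\<And>e. E [:[:e:]:] = [:e:]" "homogeneous_poly 1 l" "\<And>k. E (l ^ k) = monom 1 k"
proof (cases "c = 0")
  case False
  \<comment> \<open>The line is y = r x, so \<open>E\<close> substitutes \<open>r\<close> times the
    inner variable for the outer one, and x serves as the transverse form \<open>l\<close>.\<close>
  define r where "r = - b / c"
  define E where "E = (\<lambda>p. poly p [:0, r:])"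
  have lin: "linear_poly b c = smult [:c:] [:- [:0, r:], 1:]"
    using False by (simp add: linear_poly_def r_def)
  have unit: "is_unit [:[:c:]:]"
    using False by (simp add: is_unit_poly_iff dvd_field_iff)
  have "E p = 0 \<longleftrightarrow> linear_poly b c dvd p" for p
  proof -
    have "linear_poly b c = [:[:c:]:] * [:- [:0, r:], 1:]"
      unfolding lin by simp
    then show ?thesis
      unfolding E_def poly_eq_0_iff_dvd using mult_unit_dvd_iff'[OF unit] by metis
  qed
  moreover have "\<exists>e. E p = monom e k" if "homogeneous_poly k p" for k p
  proof -
    have "coeff (E p) i = 0" if "i \<noteq> k" for i
    proof -
      have "coeff (coeff p j * [:0, r:] ^ j) i = 0" for j
      proof -
        have *: "[:0, r:] ^ j = monom (r ^ j) j"
          using monom_power[of r 1 j] by (simp add: monom_Suc monom_0)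
        have "coeff (coeff p j) (i - j) = 0" if "j \<le> i"
          using \<open>homogeneous_poly k p\<close> \<open>i \<noteq> k\<close> that by (fastforce simp: homogeneous_poly_def)
        then show ?thesis
          by (simp add: * mult.commute[of _ "monom _ _"] coeff_monom_mult)
      qed
      then show ?thesis
        by (simp add: E_def poly_altdef coeff_sum)
    qed
    then have "E p = monom (coeff (E p) k) k"
      by (intro poly_eqI) auto
    then show ?thesis ..
  qed
  moreover have "E (varX ^ k) = monom 1 k" for k
    by (simp add: E_def varX_def monom_altdef poly_power)
  moreover have "homogeneous_poly 1 (varX :: 'k poly poly)"
    by (auto simp: homogeneous_poly_def varX_def coeff_pCons split: nat.splits)
  ultimately show ?thesis
    by (intro that[of E varX]) (auto simp: E_def)
next
  case True
  \<comment> \<open>The form is a nonzero multiple of x, so \<open>E\<close> sets x to 0 and keeps a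
    polynomial in y; the transverse form \<open>l\<close> is y.\<close>
  define E :: "'k poly poly \<Rightarrow> 'k poly" where "E = map_poly (\<lambda>q. coeff q 0)"
  have coeff_E: "coeff (E p) n = coeff (coeff p n) 0" for p n
    by (simp add: E_def coeff_map_poly)
  have lin: "linear_poly b c = [:[:0, b:]:]"
    using True by (simp add: linear_poly_def)
  have "E p = 0 \<longleftrightarrow> linear_poly b c dvd p" for p
  proof -
    have "[:0, b:] dvd q \<longleftrightarrow> coeff q 0 = 0" for q
    proof -
      have "[:0, b:] = smult b [:- 0, 1:]"
        by simp
      then have "[:0, b:] dvd q \<longleftrightarrow> [:- 0, 1:] dvd q"
        using assms True smult_dvd_iff by metis
      then show ?thesis
        by (simp only: poly_0_coeff_0 flip: poly_eq_0_iff_dvd)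
    qed
    then show ?thesis
      unfolding lin const_poly_dvd_iff by (auto simp: poly_eq_iff coeff_E)
  qed
  moreover have "\<exists>e. E p = monom e k" if "homogeneous_poly k p" for k p
  proof -
    have "E p = monom (coeff (E p) k) k"
      using that by (intro poly_eqI) (fastforce simp: homogeneous_poly_def coeff_E)
    then show ?thesis ..
  qed
  moreover have "E (p * q) = E p * E q" for p q
    by (intro poly_eqI) (simp add: coeff_E coeff_mult coeff_sum)
  moreover have "homogeneous_poly 1 (varY :: 'k poly poly)"
    by (auto simp: homogeneous_poly_def varY_def coeff_pCons split: nat.splits)
  moreover have "E (varY ^ k) = monom 1 k" for k
  proof -
    have "varY ^ k = (monom 1 k :: 'k poly poly)"
      by (simp add: varY_def monom_altdef)
    then show ?thesis
      by (intro poly_eqI) (simp add: coeff_E)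
  qed
  ultimately show ?thesis
    by (intro that[of E varY])
      (auto simp: coeff_E poly_eq_iff coeff_pCons split: nat.splits)
qed

text \<open>The multiples of the form are the zeros of the multiplicative map \<open>E\<close> into
  a domain, and \<open>E\<close> does not annihilate constants other than 0.\<close>

lemma prime_elem_linear_poly:
  fixes b c :: "'k::field"
  assumes "b \<noteq> 0 \<or> c \<noteq> 0"
  shows "prime_elem (linear_poly b c)"
proof -
  obtain E :: "'k poly poly \<Rightarrow> 'k poly" where
    E: "\<And>p q. E (p * q) = E p * E q" "\<And>p. E p = 0 \<longleftrightarrow> linear_poly b c dvd p"
      "\<And>e. E [:[:e:]:] = [:e:]"
    by (rule linear_poly_restriction[OF assms]) blast
  show ?thesis
  proof (rule prime_elemI)
    show "linear_poly b c \<noteq> 0"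
      using assms by (simp add: linear_poly_eq_0_iff)
    show "\<not> linear_poly b c dvd 1"
      using E(3)[of 1] by (simp add: one_pCons flip: E(2))
    show "linear_poly b c dvd p \<or> linear_poly b c dvd q" if "linear_poly b c dvd p * q" for p q
      using that by (simp add: E(1) flip: E(2))
  qed
qed

text \<open>On the line where the form vanishes, homogeneous polynomials become scalar multiples of
  powers of one variable. The scalar of \<open>p\<close> is nonzero, so the restriction of
  \<open>q\<close> is a multiple of that of \<open>p\<close>; a power of \<open>l\<close> lifts the
  factor to a homogeneous \<open>r\<close>.\<close>

lemma linear_poly_dvd_homogeneous_combination:
  fixes b c :: "'k::field"
  assumes "b \<noteq> 0 \<or> c \<noteq> 0"
    and "homogeneous_poly k p" "homogeneous_poly (k + n) q" "\<not> linear_poly b c dvd p"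
  obtains r where "homogeneous_poly n r" "linear_poly b c dvd q - r * p"
proof -
  obtain E :: "'k poly poly \<Rightarrow> 'k poly" and l where
    E: "\<And>p q. E (p - q) = E p - E q" "\<And>p q. E (p * q) = E p * E q"
      "\<And>p. E p = 0 \<longleftrightarrow> linear_poly b c dvd p"
      "\<And>k p. homogeneous_poly k p \<Longrightarrow> \<exists>e. E p = monom e k"
      "\<And>e. E [:[:e:]:] = [:e:]" "homogeneous_poly 1 l" "\<And>k. E (l ^ k) = monom 1 k"
    by (rule linear_poly_restriction[OF assms(1)]) blast
  obtain u v where uv: "E p = monom u k" "E q = monom v (k + n)"
    using E(4) assms(2,3) by metis
  then have "u \<noteq> 0"
    using assms(4) E(3) by fastforce
  have "E (q - [:[:v / u:]:] * l ^ n * p) = 0"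
    unfolding E(1,2,5,7) uv using \<open>u \<noteq> 0\<close> by (simp add: mult_monom smult_monom add.commute)
  moreover have "homogeneous_poly n ([:[:v / u:]:] * l ^ n)"
    using homogeneous_poly_mult[OF homogeneous_poly_const homogeneous_poly_power[OF E(6)]] by simp
  ultimately show ?thesis
    using that E(3) by blast
qed

section \<open>Derivations and their grading\<close>

interpretation der: module der_scale
  by (rule module_der_scale)

lemma der_apply_add: "der_apply (\<delta> + \<epsilon>) p = der_apply \<delta> p + der_apply \<epsilon> p"
  by (simp add: der_apply_def algebra_simps)

lemma der_apply_diff: "der_apply (\<delta> - \<epsilon>) p = der_apply \<delta> p - der_apply \<epsilon> p"
  by (simp add: der_apply_def algebra_simps)

lemma der_apply_scale: "der_apply (der_scale q \<delta>) p = q * der_apply \<delta> p"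
  by (simp add: der_apply_def der_scale_def algebra_simps)

lemma der_scale_cancel: "der_scale p \<delta> = der_scale p \<epsilon> \<longleftrightarrow> p = 0 \<or> \<delta> = \<epsilon>"
  by (auto simp: der_scale_def prod_eq_iff)

lemma der_apply_linear_poly:
  "der_apply \<delta> (linear_poly b c) = fst \<delta> * [:[:b:]:] + snd \<delta> * [:[:c:]:]"
proof -
  have "map_poly pderiv [:[:0, b:], [:c:]:] = [:[:b:]:]"
    by (intro poly_eqI) (auto simp: coeff_map_poly coeff_pCons pderiv_pCons split: nat.splits)
  then show ?thesis
    by (simp add: der_apply_def linear_poly_def dX_def dY_def pderiv_pCons)
qed

lemma homogeneous_der_diff:
  "homogeneous_der d \<delta> \<Longrightarrow> homogeneous_der d \<epsilon> \<Longrightarrow> homogeneous_der d (\<delta> - \<epsilon>)"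
  by (simp add: homogeneous_der_def homogeneous_poly_diff)

lemma homogeneous_der_scale:
  "homogeneous_poly d p \<Longrightarrow> homogeneous_der e \<delta> \<Longrightarrow> homogeneous_der (d + e) (der_scale p \<delta>)"
  by (simp add: homogeneous_der_def der_scale_def homogeneous_poly_mult)

lemma homogeneous_der_factor:
  assumes "homogeneous_poly e p" "p \<noteq> 0" "homogeneous_der n (der_scale p \<delta>)" "\<delta> \<noteq> 0"
  shows "e \<le> n" "homogeneous_der (n - e) \<delta>"
proof -
  have *: "homogeneous_poly n (p * fst \<delta>)" "homogeneous_poly n (p * snd \<delta>)"
    using assms(3) by (simp_all add: homogeneous_der_def der_scale_def)
  have "fst \<delta> \<noteq> 0 \<or> snd \<delta> \<noteq> 0"
    using assms(4) by (auto simp: prod_eq_iff)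
  then show "e \<le> n"
    using homogeneous_poly_factor(1)[OF assms(1,2)] * by blast
  show "homogeneous_der (n - e) \<delta>"
    using homogeneous_poly_factor(2)[OF assms(1,2)] * homogeneous_poly_0
    unfolding homogeneous_der_def by metis
qed

lemma homogeneous_der_apply:
  assumes "homogeneous_der d \<delta>"
  shows "homogeneous_poly d (der_apply \<delta> (linear_poly b c))"
proof -
  have "homogeneous_poly d (f * [:[:e:]:])" if "homogeneous_poly d f" for f and e :: 'a
    using homogeneous_poly_mult[OF that homogeneous_poly_const] by simp
  then show ?thesis
    using assms unfolding der_apply_linear_poly homogeneous_der_def
    by (intro homogeneous_poly_add) blast+
qed

definition homogeneous_der_part :: "nat \<Rightarrow> 'k::field derivation \<Rightarrow> 'k derivation" where
  "homogeneous_der_part n \<delta> = (homogeneous_part n (fst \<delta>), homogeneous_part n (snd \<delta>))"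

lemma homogeneous_der_part_add:
  "homogeneous_der_part n (\<delta> + \<epsilon>) = homogeneous_der_part n \<delta> + homogeneous_der_part n \<epsilon>"
  by (simp add: homogeneous_der_part_def homogeneous_part_add)

lemma homogeneous_der_part_same: "homogeneous_der n \<delta> \<Longrightarrow> homogeneous_der_part n \<delta> = \<delta>"
  by (simp add: homogeneous_der_part_def homogeneous_der_def homogeneous_part_same)

lemma homogeneous_der_part_scale:
  assumes "homogeneous_der e \<delta>"
  shows "homogeneous_der_part n (der_scale p \<delta>) =
    (if e \<le> n then der_scale (homogeneous_part (n - e) p) \<delta> else 0)"
  using assms homogeneous_part_mult[of e _ n p]
  by (auto simp: homogeneous_der_part_def homogeneous_der_def der_scale_def mult.commute[of p]
      mult.commute[of "homogeneous_part (n - e) p"] zero_prod_def)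

section \<open>Two-element bases and uniqueness of their degrees\<close>

text \<open>An ordered pair with explicit coefficients, so that a degree can be attached to each
  generator and relations can be compared coefficientwise.\<close>

definition der_basis :: "'k::field derivation set \<Rightarrow> 'k derivation \<Rightarrow> 'k derivation \<Rightarrow> bool" where
  "der_basis D \<theta>1 \<theta>2 \<longleftrightarrow>
    (\<forall>p q. der_scale p \<theta>1 + der_scale q \<theta>2 = 0 \<longrightarrow> p = 0 \<and> q = 0) \<and>
    D = {der_scale p \<theta>1 + der_scale q \<theta>2 |p q. True}"

text \<open>Equal generators would satisfy the relation with coefficients 1 and -1. For distinct
  ones, a coefficient function on the two-element set carries the same data as a pair of
  coefficients.\<close>

lemma der_basis_iff:
  "der_basis D \<theta>1 \<theta>2 \<longleftrightarrow>
    \<theta>1 \<noteq> \<theta>2 \<and> \<not> module.dependent der_scale {\<theta>1, \<theta>2} \<and> module.span der_scale {\<theta>1, \<theta>2} = D"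
proof -
  have span: "module.span der_scale {\<theta>1, \<theta>2} = {der_scale p \<theta>1 + der_scale q \<theta>2 |p q. True}"
    by (auto simp: der.span_insert der.span_singleton algebra_simps)
  have ne: "\<theta>1 \<noteq> \<theta>2" if "\<forall>p q. der_scale p \<theta>1 + der_scale q \<theta>2 = 0 \<longrightarrow> p = 0 \<and> q = 0"
    using that[rule_format, of 1 "- 1"] by (auto simp: der_scale_def prod_eq_iff)
  have indep: "\<not> module.dependent der_scale {\<theta>1, \<theta>2} \<longleftrightarrow>
      (\<forall>p q. der_scale p \<theta>1 + der_scale q \<theta>2 = 0 \<longrightarrow> p = 0 \<and> q = 0)" if "\<theta>1 \<noteq> \<theta>2"
  proof -
    have "(\<exists>u. P (u \<theta>1) (u \<theta>2)) \<longleftrightarrow> (\<exists>p q. P p q)" for P :: "'a poly poly \<Rightarrow> 'a poly poly \<Rightarrow> bool"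
    proof
      assume "\<exists>p q. P p q"
      then obtain p q where "P p q" by blast
      then show "\<exists>u. P (u \<theta>1) (u \<theta>2)"
        using that by (intro exI[of _ "\<lambda>v. if v = \<theta>1 then p else q"]) simp
    qed blast
    from this[of "\<lambda>p q. (p \<noteq> 0 \<or> q \<noteq> 0) \<and> der_scale p \<theta>1 + der_scale q \<theta>2 = 0"]
    show ?thesis
      using that by (auto simp: der.dependent_finite)
  qed
  show ?thesis
    unfolding der_basis_def span using ne indep by metis
qed

lemma basis_degrees_iff:
  "basis_degrees A a \<mu> d1 d2 \<longleftrightarrow>
    (\<exists>\<theta>1 \<theta>2. der_basis (log_derivations A a \<mu>) \<theta>1 \<theta>2 \<and> homogeneous_der d1 \<theta>1 \<and> homogeneous_der d2 \<theta>2)"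
  unfolding basis_degrees_def der_basis_iff by blast

lemma der_basis_independent:
  assumes "der_basis D \<theta>1 \<theta>2" "der_scale p \<theta>1 + der_scale q \<theta>2 = der_scale p' \<theta>1 + der_scale q' \<theta>2"
  shows "p = p'" "q = q'"
proof -
  have "der_scale (p - p') \<theta>1 + der_scale (q - q') \<theta>2 = 0"
    using assms(2) by (simp add: der.scale_left_diff_distrib algebra_simps)
  then have "p - p' = 0 \<and> q - q' = 0"
    using assms(1) unfolding der_basis_def by blast
  then show "p = p'" "q = q'" by simp_all
qed

lemma der_basis_obtain:
  assumes "der_basis D \<theta>1 \<theta>2" "\<eta> \<in> D"
  obtains p q where "\<eta> = der_scale p \<theta>1 + der_scale q \<theta>2"
  using assms unfolding der_basis_def by blast

lemma der_basis_mem: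
  assumes "der_basis D \<theta>1 \<theta>2"
  shows "\<theta>1 \<in> D" "\<theta>2 \<in> D"
proof -
  have "\<theta>1 = der_scale 1 \<theta>1 + der_scale 0 \<theta>2" "\<theta>2 = der_scale 0 \<theta>1 + der_scale 1 \<theta>2"
    by simp_all
  then show "\<theta>1 \<in> D" "\<theta>2 \<in> D"
    using assms unfolding der_basis_def by blast+
qed

lemma der_basis_nonzero:
  assumes "der_basis D \<theta>1 \<theta>2"
  shows "\<theta>1 \<noteq> 0" "\<theta>2 \<noteq> 0"
  using der_basis_independent[OF assms, of 1 0 0 0] der_basis_independent[OF assms, of 0 1 0 0]
  by auto

lemma der_basis_swap: "der_basis D \<theta>1 \<theta>2 \<Longrightarrow> der_basis D \<theta>2 \<theta>1"
  unfolding der_basis_iff by (metis insert_commute)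

lemma der_basis_shear:
  assumes "der_basis D \<theta>1 \<theta>2"
  shows "der_basis D \<theta>1 (\<theta>2 - der_scale r \<theta>1)"
proof -
  have eq: "der_scale p \<theta>1 + der_scale q (\<theta>2 - der_scale r \<theta>1) =
      der_scale (p - q * r) \<theta>1 + der_scale q \<theta>2" for p q
    by (simp add: der.scale_right_diff_distrib der.scale_left_diff_distrib)
  have "p = 0 \<and> q = 0" if "der_scale (p - q * r) \<theta>1 + der_scale q \<theta>2 = 0" for p q
    using assms that unfolding der_basis_def by fastforce
  moreover have "D = {der_scale (p - q * r) \<theta>1 + der_scale q \<theta>2 |p q. True}"
  proof -
    have "der_scale p \<theta>1 + der_scale q \<theta>2 = der_scale ((p + q * r) - q * r) \<theta>1 + der_scale q \<theta>2" for p q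
      by simp
    then show ?thesis
      using assms unfolding der_basis_def by blast
  qed
  ultimately show ?thesis
    unfolding der_basis_def eq by blast
qed

text \<open>In the part of degree \<open>d\<close> of an expansion of \<open>\<eta>\<close>, the
  second generator cannot occur because its degree is already too large.\<close>

lemma der_basis_homogeneous_element:
  assumes "der_basis D \<theta>1 \<theta>2" "homogeneous_der d1 \<theta>1" "homogeneous_der d2 \<theta>2"
    and "\<eta> \<in> D" "homogeneous_der d \<eta>" "\<eta> \<noteq> 0" "d < d2"
  obtains g where "d1 \<le> d" "homogeneous_poly (d - d1) g" "\<eta> = der_scale g \<theta>1"
proof -
  obtain p q where pq: "\<eta> = der_scale p \<theta>1 + der_scale q \<theta>2"
    using der_basis_obtain assms(1,4) by blast
  have "\<eta> = (if d1 \<le> d then der_scale (homogeneous_part (d - d1) p) \<theta>1 else 0)"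
    using homogeneous_der_part_same[OF assms(5)] assms(7)
    unfolding pq homogeneous_der_part_add homogeneous_der_part_scale[OF assms(2)]
      homogeneous_der_part_scale[OF assms(3)] by simp
  then show ?thesis
    using that assms(6) homogeneous_homogeneous_part by (metis (full_types))
qed

lemma der_basis_min_degree:
  assumes "der_basis D \<theta>1 \<theta>2" "homogeneous_der d1 \<theta>1" "homogeneous_der d2 \<theta>2" "d1 \<le> d2"
    and "\<eta> \<in> D" "homogeneous_der d \<eta>" "\<eta> \<noteq> 0"
  shows "d1 \<le> d"
  using der_basis_homogeneous_element[OF assms(1-3,5-7)] assms(4) by (meson linorder_not_less order.trans)

text \<open>Otherwise both \<open>\<tau>1\<close> and \<open>\<tau>2\<close> have degree below
  \<open>d2\<close>, hence are multiples \<open>g\<close> and \<open>h\<close> of the same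
  \<open>\<theta>1\<close>. Then \<open>h\<close> times \<open>\<tau>1\<close> equals
  \<open>g\<close> times \<open>\<tau>2\<close>, which violates independence.\<close>

lemma der_basis_max_degree:
  assumes "der_basis D \<theta>1 \<theta>2" "homogeneous_der d1 \<theta>1" "homogeneous_der d2 \<theta>2"
    and "der_basis D \<tau>1 \<tau>2" "homogeneous_der e1 \<tau>1" "homogeneous_der e2 \<tau>2" "e1 \<le> e2"
  shows "d2 \<le> e2"
proof (rule ccontr)
  assume "\<not> d2 \<le> e2"
  then have "e1 < d2" "e2 < d2"
    using assms(7) by simp_all
  note elem = der_basis_homogeneous_element[OF assms(1-3)]
  obtain g where g: "\<tau>1 = der_scale g \<theta>1"
    using elem[OF _ assms(5) _ \<open>e1 < d2\<close>] der_basis_mem der_basis_nonzero assms(4) by metis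
  obtain h where h: "\<tau>2 = der_scale h \<theta>1"
    using elem[OF _ assms(6) _ \<open>e2 < d2\<close>] der_basis_mem der_basis_nonzero assms(4) by metis
  have "der_scale h \<tau>1 + der_scale 0 \<tau>2 = der_scale 0 \<tau>1 + der_scale g \<tau>2"
    by (simp add: g h mult.commute)
  from der_basis_independent[OF assms(4) this] have "\<tau>2 = 0"
    by (simp add: h)
  then show False
    using der_basis_nonzero assms(4) by blast
qed

lemma basis_degrees_unique:
  assumes "basis_degrees A a \<mu> d1 d2" "basis_degrees A a \<mu> e1 e2" "d1 \<le> d2" "e1 \<le> e2"
  shows "d1 = e1" "d2 = e2"
proof -
  have "d1 \<le> e1 \<and> d2 \<le> e2"
    if *: "basis_degrees A a \<mu> d1 d2" "basis_degrees A a \<mu> e1 e2"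
      and le: "d1 \<le> d2" "e1 \<le> e2" for d1 d2 e1 e2
  proof -
    obtain \<theta>1 \<theta>2 \<tau>1 \<tau>2 where b:
      "der_basis (log_derivations A a \<mu>) \<theta>1 \<theta>2" "homogeneous_der d1 \<theta>1" "homogeneous_der d2 \<theta>2"
      "der_basis (log_derivations A a \<mu>) \<tau>1 \<tau>2" "homogeneous_der e1 \<tau>1" "homogeneous_der e2 \<tau>2"
      using * unfolding basis_degrees_iff by metis
    show ?thesis
      using der_basis_min_degree[OF b(1-3) le(1), of \<tau>1 e1] der_basis_max_degree[OF b le(2)]
        der_basis_mem[OF b(4)] der_basis_nonzero[OF b(4)] b(5) by blast
  qed
  from this[OF assms] this[OF assms(2,1,4,3)] show "d1 = e1" "d2 = e2"
    by simp_all
qed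

lemma basis_degrees_swap: "basis_degrees A a \<mu> d1 d2 \<Longrightarrow> basis_degrees A a \<mu> d2 d1"
  unfolding basis_degrees_iff using der_basis_swap by blast

lemma Delta_eq:
  assumes "basis_degrees A a \<mu> d1 d2" "d1 \<le> d2"
  shows "Delta A a \<mu> = d2 - d1"
  unfolding Delta_def
proof (rule the_equality)
  show "\<exists>e1 e2. basis_degrees A a \<mu> e1 e2 \<and> int (d2 - d1) = \<bar>int e1 - int e2\<bar>"
    using assms by (intro exI[of _ d1] exI[of _ d2]) auto
next
  fix n
  assume "\<exists>e1 e2. basis_degrees A a \<mu> e1 e2 \<and> int n = \<bar>int e1 - int e2\<bar>"
  then obtain e1 e2 where e: "basis_degrees A a \<mu> e1 e2" "int n = \<bar>int e1 - int e2\<bar>"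
    by blast
  then show "n = d2 - d1"
    using basis_degrees_unique[OF assms(1) e(1) assms(2)]
      basis_degrees_unique[OF assms(1) basis_degrees_swap[OF e(1)] assms(2)]
    by (cases "e1 \<le> e2") auto
qed

section \<open>Cancelling cofactors prime to a product of prime powers\<close>

lemma prime_elem_power_dvd_mult:
  fixes p :: "'r::idom"
  assumes "prime_elem p" "\<not> p dvd x"
  shows "p ^ n dvd x * y \<longleftrightarrow> p ^ n dvd y"
proof
  show "p ^ n dvd x * y \<Longrightarrow> p ^ n dvd y"
  proof (induction n)
    case (Suc n)
    then obtain z where z: "y = p ^ n * z"
      by (metis dvdE dvd_mult_right power_Suc)
    have "p ^ n * p dvd p ^ n * (x * z)"
      using Suc.prems by (simp add: z mult_ac)
    then have "p dvd x * z"
      using prime_elem_not_zeroI[OF assms(1)] by simp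
    then show ?case
      using assms by (simp add: z prime_elem_dvd_mult_iff mult.commute mult_dvd_mono)
  qed simp
qed simp

text \<open>Each prime power is divided out of \<open>x\<close> before the next one is treated, so
  the argument stays with primes and avoids greatest common divisors. Primality to \<open>g\<close>
  is demanded only for positive exponents, since \<open>g\<close> may well contain the other
  forms.\<close>

lemma prime_elem_prod_power_dvd_mult:
  fixes f :: "'h \<Rightarrow> 'r::idom"
  assumes "finite B" "\<And>H. H \<in> B \<Longrightarrow> k H > 0 \<Longrightarrow> prime_elem (f H) \<and> \<not> f H dvd g"
    and "(\<Prod>H\<in>B. f H ^ k H) dvd g * x"
  shows "(\<Prod>H\<in>B. f H ^ k H) dvd x"
  using assms
proof (induction B arbitrary: x rule: finite_induct)
  case (insert H B)
  show ?case
  proof (cases "k H = 0")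
    case True
    then have "(\<Prod>H\<in>insert H B. f H ^ k H) = (\<Prod>H\<in>B. f H ^ k H)"
      using insert.hyps by simp
    then show ?thesis
      using insert.IH insert.prems by (metis insertCI)
  next
    case False
    then have H: "prime_elem (f H)" "\<not> f H dvd g"
      using insert.prems by auto
    have *: "f H ^ k H * (\<Prod>H\<in>B. f H ^ k H) dvd g * x"
      using insert.prems(2) insert.hyps by simp
    then obtain x' where x': "x = f H ^ k H * x'"
      using prime_elem_power_dvd_mult[OF H] by (meson dvdE dvd_mult_left)
    have "f H ^ k H * (\<Prod>H\<in>B. f H ^ k H) dvd f H ^ k H * (g * x')"
      using * by (simp add: x' mult_ac)
    then have "(\<Prod>H\<in>B. f H ^ k H) dvd g * x'"
      using prime_elem_not_zeroI[OF H(1)] by simp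
    then have "(\<Prod>H\<in>B. f H ^ k H) dvd x'"
      using insert.IH insert.prems(1) by blast
    then show ?thesis
      using insert.hyps by (simp add: x' mult_dvd_mono)
  qed
qed simp

lemma der_scale_dvdE:
  assumes "p dvd fst \<delta>" "p dvd snd \<delta>"
  obtains \<epsilon> where "\<delta> = der_scale p \<epsilon>"
proof -
  obtain f g where "fst \<delta> = p * f" "snd \<delta> = p * g"
    using assms by (elim dvdE)
  then show ?thesis
    by (intro that[of "(f, g)"]) (simp add: der_scale_def prod_eq_iff)
qed

lemma homogeneous_poly_0_iff: "homogeneous_poly 0 p \<longleftrightarrow> p = [:[:coeff (coeff p 0) 0:]:]"
proof
  assume "homogeneous_poly 0 p"
  then show "p = [:[:coeff (coeff p 0) 0:]:]"
    by (intro poly_eqI) (auto simp: homogeneous_poly_def coeff_pCons split: nat.splits)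
next
  assume "p = [:[:coeff (coeff p 0) 0:]:]"
  then show "homogeneous_poly 0 p"
    by (metis homogeneous_poly_const)
qed

text \<open>The quotient has degree 0, hence is constant, and the two coefficient vectors are
  proportional. The conclusion expresses this as a vanishing determinant.\<close>

lemma linear_poly_dvd_linear_polyD:
  assumes "b \<noteq> 0 \<or> c \<noteq> (0 :: 'k::field)" "b' \<noteq> 0 \<or> c' \<noteq> 0" "linear_poly b c dvd linear_poly b' c'"
  shows "b * c' = b' * c"
proof -
  obtain q where q: "linear_poly b' c' = linear_poly b c * q"
    using assms(3) by (elim dvdE)
  have "linear_poly b c \<noteq> 0" "q \<noteq> 0"
    using assms(1,2) q linear_poly_eq_0_iff by (metis mult_zero_right)+
  then have "homogeneous_poly (1 - 1) q"
    using homogeneous_poly_factor(2)[OF homogeneous_linear_poly, of b c 1 q]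
      homogeneous_linear_poly q by metis
  then obtain e where "q = [:[:e:]:]"
    using homogeneous_poly_0_iff by auto
  then show ?thesis
    using q by (simp add: linear_poly_def mult_ac)
qed

section \<open>Bases of D(\<mu>) under raising a multiplicity\<close>

text \<open>The geometry of V is reduced to coefficient pairs: distinctness of the lines becomes the
  nonvanishing of 2 by 2 determinants.\<close>

locale line_arrangement =
  fixes A :: "'h set" and a :: "'h \<Rightarrow> 'k::field poly poly" and b c :: "'h \<Rightarrow> 'k"
  assumes finite_A: "finite A"
    and a_eq: "H \<in> A \<Longrightarrow> a H = linear_poly (b H) (c H)"
    and nonzero: "H \<in> A \<Longrightarrow> b H \<noteq> 0 \<or> c H \<noteq> 0"
    and nonparallel: "H \<in> A \<Longrightarrow> H' \<in> A \<Longrightarrow> H \<noteq> H' \<Longrightarrow> b H * c H' \<noteq> b H' * c H"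
begin

abbreviation "D \<equiv> log_derivations A a"

lemma D_iff: "\<delta> \<in> D \<mu> \<longleftrightarrow> (\<forall>H\<in>A. a H ^ \<mu> H dvd der_apply \<delta> (a H))"
  by (simp add: log_derivations_def)

lemma D_scale: "\<delta> \<in> D \<mu> \<Longrightarrow> der_scale p \<delta> \<in> D \<mu>"
  by (simp add: D_iff der_apply_scale)

lemma D_add: "\<delta> \<in> D \<mu> \<Longrightarrow> \<epsilon> \<in> D \<mu> \<Longrightarrow> \<delta> + \<epsilon> \<in> D \<mu>"
  by (simp add: D_iff der_apply_add)

lemma prime: "H \<in> A \<Longrightarrow> prime_elem (a H)"
  using a_eq nonzero prime_elem_linear_poly by metis

lemma a_nonzero: "H \<in> A \<Longrightarrow> a H \<noteq> 0"
  using prime prime_elem_not_zeroI by blast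

lemma homogeneous_a: "H \<in> A \<Longrightarrow> homogeneous_poly 1 (a H)"
  using a_eq homogeneous_linear_poly by metis

lemma not_dvd: "H \<in> A \<Longrightarrow> H' \<in> A \<Longrightarrow> H \<noteq> H' \<Longrightarrow> \<not> a H dvd a H'"
  using linear_poly_dvd_linear_polyD nonzero nonparallel a_eq by metis

lemma not_dvd_prod:
  assumes "H \<in> A" "B \<subseteq> A - {H}"
  shows "\<not> a H dvd (\<Prod>H'\<in>B. a H' ^ k H')"
proof -
  have "finite B"
    using assms(2) finite_A by (meson finite_Diff finite_subset)
  then show ?thesis
    using assms(2)
  proof (induction B rule: finite_induct)
    case empty
    show ?case
      using prime[OF assms(1)] by (simp add: prime_elem_def)
  next
    case (insert H' B)
    then show ?case
      using prime[OF assms(1)] not_dvd[OF assms(1), of H']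
      by (auto simp: prime_elem_dvd_mult_iff dest: prime_elem_dvd_power)
  qed
qed

lemma prod_power_split:
  "H \<in> A \<Longrightarrow> (\<Prod>H\<in>A. a H ^ k H) = a H ^ k H * (\<Prod>H'\<in>A - {H}. a H' ^ k H')"
  using finite_A by (simp add: prod.remove)

lemma mult_size_upd:
  "H \<in> A \<Longrightarrow> mult_size A (\<mu>(H := n)) + \<mu> H = mult_size A \<mu> + n"
  using finite_A by (simp add: mult_size_def sum.remove cong: sum.cong_simp)

lemma D_fun_upd_Suc:
  assumes "H \<in> A"
  shows "D (\<mu>(H := Suc (\<mu> H))) = {\<eta> \<in> D \<mu>. a H ^ Suc (\<mu> H) dvd der_apply \<eta> (a H)}"
proof -
  have "\<eta> \<in> D (\<mu>(H := Suc (\<mu> H))) \<longleftrightarrow>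
      \<eta> \<in> D \<mu> \<and> a H ^ Suc (\<mu> H) dvd der_apply \<eta> (a H)" for \<eta>
  proof (intro iffI conjI)
    assume "\<eta> \<in> D (\<mu>(H := Suc (\<mu> H)))"
    then have eta_dvd: "a H' ^ (\<mu>(H := Suc (\<mu> H))) H' dvd der_apply \<eta> (a H')" if "H' \<in> A" for H'
      using that by (simp only: D_iff)
    show *: "a H ^ Suc (\<mu> H) dvd der_apply \<eta> (a H)"
      using eta_dvd[OF assms] by (simp only: fun_upd_same)
    have "a H' ^ \<mu> H' dvd der_apply \<eta> (a H')" if "H' \<in> A" for H'
    proof (cases "H' = H")
      case True
      show ?thesis
        unfolding True by (rule power_le_dvd[OF *]) simp
    next
      case False
      then show ?thesis
        using eta_dvd[OF that] by (simp only: fun_upd_other not_False_eq_True)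
    qed
    then show "\<eta> \<in> D \<mu>"
      by (simp only: D_iff) blast
  next
    assume \<eta>: "\<eta> \<in> D \<mu> \<and> a H ^ Suc (\<mu> H) dvd der_apply \<eta> (a H)"
    have "a H' ^ (\<mu>(H := Suc (\<mu> H))) H' dvd der_apply \<eta> (a H')" if "H' \<in> A" for H'
    proof (cases "H' = H")
      case True
      show ?thesis
        unfolding True fun_upd_same using \<eta> by (rule conjunct2)
    next
      case False
      then have "(\<mu>(H := Suc (\<mu> H))) H' = \<mu> H'"
        by (rule fun_upd_other)
      then show ?thesis
        using \<eta> that by (simp only: D_iff)
    qed
    then show "\<eta> \<in> D (\<mu>(H := Suc (\<mu> H)))"
      by (simp only: D_iff) blast
  qed
  then show ?thesis
    by (intro set_eqI) (simp only: mem_Collect_eq)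
qed

text \<open>Raising the multiplicity at \<open>H\<close> really shrinks the module. The witness is a
  constant derivation with nonzero value on \<open>a H\<close>, multiplied by all
  \<open>a H ^ \<mu> H\<close>; the other forms contribute no further factor
  \<open>a H\<close>.\<close>

lemma exists_sharp_derivation:
  assumes "H \<in> A"
  obtains \<eta> where "\<eta> \<in> D \<mu>" "\<not> a H ^ Suc (\<mu> H) dvd der_apply \<eta> (a H)"
proof -
  obtain \<epsilon> e where e: "der_apply \<epsilon> (a H) = [:[:e:]:]" "e \<noteq> 0"
  proof -
    have "der_apply (1, 0) (a H) = [:[:b H:]:]" "der_apply (0, 1) (a H) = [:[:c H:]:]"
      using a_eq assms by (simp_all add: der_apply_linear_poly)
    then show ?thesis
      using that nonzero[OF assms] by blast
  qed
  define f where "f = (\<Prod>H\<in>A. a H ^ \<mu> H)"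
  have "der_scale f \<epsilon> \<in> D \<mu>"
    using finite_A by (auto simp: D_iff der_apply_scale f_def intro: dvd_mult2 dvd_prodI)
  moreover have "\<not> a H ^ Suc (\<mu> H) dvd der_apply (der_scale f \<epsilon>) (a H)"
  proof
    define g where "g = (\<Prod>H'\<in>A - {H}. a H' ^ \<mu> H')"
    assume "a H ^ Suc (\<mu> H) dvd der_apply (der_scale f \<epsilon>) (a H)"
    then have "a H ^ \<mu> H * a H dvd a H ^ \<mu> H * (g * [:[:e:]:])"
      unfolding der_apply_scale e f_def prod_power_split[OF assms] g_def
      by (simp only: power_Suc2 mult.assoc)
    then have "a H dvd g * [:[:e:]:]"
      using a_nonzero[OF assms] by (simp only: dvd_mult_cancel_left power_not_zero simp_thms)
    moreover have "is_unit [:[:e:]:]"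
      using e(2) by (simp add: is_unit_poly_iff dvd_field_iff)
    ultimately have "a H dvd g"
      by (simp only: dvd_mult_unit_iff)
    then show False
      using not_dvd_prod[OF assms, of "A - {H}"] g_def by blast
  qed
  ultimately show ?thesis
    by (rule that)
qed

text \<open>\<open>\<theta>1\<close> survives, so \<open>\<theta>2\<close> cannot: otherwise all of
  \<open>D \<mu>\<close> would satisfy the stronger condition. By primality, an element of the
  smaller module then has a coefficient of \<open>\<theta>2\<close> divisible by
  \<open>a H\<close>.\<close>

lemma der_basis_fun_upd_Suc:
  assumes H: "H \<in> A" and basis: "der_basis (D \<mu>) \<theta>1 \<theta>2"
    and dvd: "a H ^ Suc (\<mu> H) dvd der_apply \<theta>1 (a H)"
  shows "der_basis (D (\<mu>(H := Suc (\<mu> H)))) \<theta>1 (der_scale (a H) \<theta>2)"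
proof -
  have not_dvd: "\<not> a H ^ Suc (\<mu> H) dvd der_apply \<theta>2 (a H)"
  proof
    assume "a H ^ Suc (\<mu> H) dvd der_apply \<theta>2 (a H)"
    then have "a H ^ Suc (\<mu> H) dvd der_apply \<eta> (a H)" if "\<eta> \<in> D \<mu>" for \<eta>
      using der_basis_obtain[OF basis that] dvd by (metis der_apply_add der_apply_scale dvd_add dvd_mult)
    then show False
      using exists_sharp_derivation[OF H] by blast
  qed
  have "p = 0 \<and> q = 0" if "der_scale p \<theta>1 + der_scale q (der_scale (a H) \<theta>2) = 0" for p q
    using that basis a_nonzero[OF H] unfolding der_basis_def der.scale_scale by fastforce
  moreover have "D (\<mu>(H := Suc (\<mu> H))) = {der_scale p \<theta>1 + der_scale q (der_scale (a H) \<theta>2) |p q. True}"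
  proof (intro equalityI subsetI)
    fix \<eta>
    assume "\<eta> \<in> D (\<mu>(H := Suc (\<mu> H)))"
    then have \<eta>: "\<eta> \<in> D \<mu>" "a H ^ Suc (\<mu> H) dvd der_apply \<eta> (a H)"
      by (auto simp: D_fun_upd_Suc[OF H])
    obtain p q where pq: "\<eta> = der_scale p \<theta>1 + der_scale q \<theta>2"
      using der_basis_obtain[OF basis \<eta>(1)] .
    have "a H ^ Suc (\<mu> H) dvd q * der_apply \<theta>2 (a H)"
      using \<eta>(2) dvd unfolding pq der_apply_add der_apply_scale by (metis dvd_add_right_iff dvd_mult)
    then have "a H dvd q"
      using prime_elem_power_dvd_mult[OF prime[OF H]] not_dvd by blast
    then obtain q' where "q = q' * a H"
      by (metis dvdE mult.commute)
    then have "\<eta> = der_scale p \<theta>1 + der_scale q' (der_scale (a H) \<theta>2)"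
      unfolding pq by simp
    then show "\<eta> \<in> {der_scale p \<theta>1 + der_scale q (der_scale (a H) \<theta>2) |p q. True}"
      by auto
  next
    fix \<eta>
    assume "\<eta> \<in> {der_scale p \<theta>1 + der_scale q (der_scale (a H) \<theta>2) |p q. True}"
    then obtain p q where \<eta>: "\<eta> = der_scale p \<theta>1 + der_scale q (der_scale (a H) \<theta>2)"
      by auto
    have "a H ^ \<mu> H dvd der_apply \<theta>2 (a H)"
      using der_basis_mem(2)[OF basis] H by (simp add: D_iff)
    then have dvd': "a H ^ Suc (\<mu> H) dvd a H * der_apply \<theta>2 (a H)"
      by (simp add: mult_dvd_mono)
    have "a H ^ Suc (\<mu> H) dvd der_apply \<eta> (a H)"
      unfolding \<eta> der_apply_add der_apply_scale by (rule dvd_add[OF dvd_mult[OF dvd] dvd_mult[OF dvd']])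
    moreover have "\<eta> \<in> D \<mu>"
      unfolding \<eta> by (intro D_add D_scale der_basis_mem[OF basis])
    ultimately show "\<eta> \<in> D (\<mu>(H := Suc (\<mu> H)))"
      by (simp add: D_fun_upd_Suc[OF H])
  qed
  ultimately show ?thesis
    unfolding der_basis_def by blast
qed

text \<open>Exactly one generator has to be multiplied by \<open>a H\<close>. If
  \<open>\<theta>1\<close> does not survive, a multiple of it is subtracted from
  \<open>\<theta>2\<close> to make the result survive instead; homogeneity of the multiplier is
  possible because \<open>d1 \<le> d2\<close>.\<close>

lemma basis_degrees_fun_upd_Suc:
  assumes H: "H \<in> A" and deg: "basis_degrees A a \<mu> d1 d2" and le: "d1 \<le> d2"
  shows "basis_degrees A a (\<mu>(H := Suc (\<mu> H))) d1 (Suc d2) \<or>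
    basis_degrees A a (\<mu>(H := Suc (\<mu> H))) (Suc d1) d2"
proof -
  obtain \<theta>1 \<theta>2 where basis: "der_basis (D \<mu>) \<theta>1 \<theta>2"
    and hom: "homogeneous_der d1 \<theta>1" "homogeneous_der d2 \<theta>2"
    using deg unfolding basis_degrees_iff by blast
  have hom': "homogeneous_der (Suc d1) (der_scale (a H) \<theta>1)"
    "homogeneous_der (Suc d2) (der_scale (a H) \<theta>2)"
    using homogeneous_der_scale[OF homogeneous_a[OF H]] hom by fastforce+
  show ?thesis
  proof (cases "a H ^ Suc (\<mu> H) dvd der_apply \<theta>1 (a H)")
    case True
    then show ?thesis
      using der_basis_fun_upd_Suc[OF H basis] hom hom' unfolding basis_degrees_iff by blast
  next
    case False
    obtain g1 g2 where g: "der_apply \<theta>1 (a H) = a H ^ \<mu> H * g1" "der_apply \<theta>2 (a H) = a H ^ \<mu> H * g2"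
      using der_basis_mem[OF basis] H by (metis D_iff dvdE)
    have not_dvd: "\<not> a H dvd g1"
      using False a_nonzero[OF H] by (simp add: g mult.commute[of "a H"])
    have pow: "homogeneous_poly (\<mu> H) (a H ^ \<mu> H)" "a H ^ \<mu> H \<noteq> 0"
      using homogeneous_poly_power[OF homogeneous_a[OF H], of "\<mu> H"] a_nonzero[OF H] by simp_all
    have hom_g: "homogeneous_poly d1 (a H ^ \<mu> H * g1)" "homogeneous_poly d2 (a H ^ \<mu> H * g2)"
      using homogeneous_der_apply hom a_eq[OF H] unfolding g[symmetric] by metis+
    \<comment> \<open>\<open>r\<close> cancels the restriction of \<open>g2\<close> to the line
      \<open>a H = 0\<close> against that of \<open>g1\<close>. The case \<open>g2 = 0\<close> is
      separate because a zero cofactor is excluded when degrees are read off from a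
      factorisation.\<close>
    obtain r where r: "homogeneous_poly (d2 - d1) r" "a H dvd g2 - r * g1"
    proof (cases "g2 = 0")
      case True
      then show ?thesis
        using that[of 0] by simp
    next
      case False
      have "g1 \<noteq> 0"
        using not_dvd by auto
      have 1: "\<mu> H \<le> d1" "homogeneous_poly (d1 - \<mu> H) g1"
        using homogeneous_poly_factor[OF pow hom_g(1) \<open>g1 \<noteq> 0\<close>] .
      have "homogeneous_poly (d2 - \<mu> H) g2"
        using homogeneous_poly_factor[OF pow hom_g(2) False] by blast
      also have "d2 - \<mu> H = (d1 - \<mu> H) + (d2 - d1)"
        using 1 le by simp
      finally show ?thesis
        using linear_poly_dvd_homogeneous_combination[OF nonzero[OF H] 1(2)] not_dvd that
        unfolding a_eq[OF H] by blast
    qed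
    \<comment> \<open>The roles are now exchanged: \<open>\<tau>\<close> survives with degree
      \<open>d2\<close>, and \<open>\<theta>1\<close> is the generator whose degree grows.\<close>
    define \<tau> where "\<tau> = \<theta>2 - der_scale r \<theta>1"
    have "der_basis (D \<mu>) \<tau> \<theta>1"
      unfolding \<tau>_def using der_basis_swap[OF der_basis_shear[OF basis]] .
    moreover have "der_apply \<tau> (a H) = a H ^ \<mu> H * (g2 - r * g1)"
      by (simp add: \<tau>_def der_apply_diff der_apply_scale g right_diff_distrib mult.left_commute)
    then have "a H ^ Suc (\<mu> H) dvd der_apply \<tau> (a H)"
      using r(2) unfolding power_Suc2 by (simp add: mult_dvd_mono)
    ultimately have "der_basis (D (\<mu>(H := Suc (\<mu> H)))) \<tau> (der_scale (a H) \<theta>1)"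
      by (rule der_basis_fun_upd_Suc[OF H])
    moreover have "homogeneous_der d2 \<tau>"
      using homogeneous_der_scale[OF r(1) hom(1)] le hom(2) by (simp add: \<tau>_def homogeneous_der_diff)
    ultimately show ?thesis
      using hom' basis_degrees_swap unfolding basis_degrees_iff by blast
  qed
qed

text \<open>Induction on the size, starting from the two partial derivatives in degree 0. Each
  raised multiplicity adds one to the sum of the degrees, which gives existence of a basis and the
  value of the sum together.\<close>

lemma exponents:
  obtains d1 d2 where "basis_degrees A a \<mu> d1 d2" "d1 \<le> d2" "d1 + d2 = mult_size A \<mu>"
    "Delta A a \<mu> = d2 - d1"
proof -
  have "\<exists>d1 d2. basis_degrees A a \<mu> d1 d2 \<and> d1 + d2 = mult_size A \<mu>"
  proof (induction "mult_size A \<mu>" arbitrary: \<mu>)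
    case 0
    then have "D \<mu> = UNIV"
      using finite_A by (auto simp: mult_size_def D_iff)
    moreover have "der_basis UNIV (1, 0) (0, 1 :: 'k poly poly)"
      by (auto simp: der_basis_def der_scale_def zero_prod_def)
    ultimately have "basis_degrees A a \<mu> 0 0"
      unfolding basis_degrees_iff homogeneous_der_def
      by (intro exI[of _ "(1, 0)"] exI[of _ "(0, 1)"]) (simp add: homogeneous_poly_1)
    then show ?case
      using 0 by fastforce
  next
    case (Suc n)
    then obtain H where H: "H \<in> A" "\<mu> H > 0"
      by (metis bot_nat_0.not_eq_extremum mult_size_def nat.distinct(1) sum.neutral)
    define \<nu> where "\<nu> = \<mu>(H := \<mu> H - 1)"
    have \<mu>: "\<mu> = \<nu>(H := Suc (\<nu> H))"
      using H by (auto simp: \<nu>_def)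
    have size: "n = mult_size A \<nu>"
      using mult_size_upd[OF H(1), of \<mu> "\<mu> H - 1"] H(2) Suc.hyps(2) by (simp add: \<nu>_def)
    obtain d1 d2 where "basis_degrees A a \<nu> d1 d2" "d1 + d2 = n"
      using Suc.hyps(1)[OF size] size by auto
    then obtain d1 d2 where "basis_degrees A a \<nu> d1 d2" "d1 + d2 = n" "d1 \<le> d2"
      using basis_degrees_swap by (metis add.commute nle_le)
    then show ?case
      using basis_degrees_fun_upd_Suc[OF H(1), of \<nu> d1 d2] Suc.hyps(2) unfolding \<mu>[symmetric] by force
  qed
  then obtain d1 d2 where "basis_degrees A a \<mu> d1 d2" "d1 + d2 = mult_size A \<mu>"
    by blast
  then obtain d1 d2 where "basis_degrees A a \<mu> d1 d2" "d1 \<le> d2" "d1 + d2 = mult_size A \<mu>"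
    using basis_degrees_swap by (metis add.commute nle_le)
  then show ?thesis
    using that Delta_eq by blast
qed

text \<open>The smaller basis degree is at most \<open>e\<close>, and the two degrees add up to
  \<open>mult_size A \<mu>\<close>. The additive form avoids truncated subtraction.\<close>

lemma Delta_lower_bound:
  assumes "\<eta> \<in> D \<mu>" "homogeneous_der e \<eta>" "\<eta> \<noteq> 0"
  shows "mult_size A \<mu> \<le> Delta A a \<mu> + 2 * e"
proof -
  obtain d1 d2 where d: "basis_degrees A a \<mu> d1 d2" "d1 \<le> d2" "d1 + d2 = mult_size A \<mu>"
    "Delta A a \<mu> = d2 - d1"
    by (rule exponents)
  have "d1 \<le> e"
    using d(1) der_basis_min_degree[OF _ _ _ d(2) assms] unfolding basis_degrees_iff by blast
  then show ?thesis
    using d by simp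
qed

end

section \<open>The smaller generator at a local maximum of Delta\<close>

text \<open>Maximality is recorded for immediate neighbours only. Where \<open>\<mu> H = 0\<close>,
  truncated subtraction makes \<open>down\<close> compare \<open>\<mu>\<close> with itself.\<close>

locale local_maximum = line_arrangement A a b c
  for A :: "'h set" and a :: "'h \<Rightarrow> 'k::field poly poly" and b c :: "'h \<Rightarrow> 'k" +
  fixes \<mu> :: "'h \<Rightarrow> nat" and \<theta> \<theta>' :: "'k derivation" and d d' :: nat
  assumes basis: "der_basis (D \<mu>) \<theta> \<theta>'"
    and hom: "homogeneous_der d \<theta>" "homogeneous_der d' \<theta>'"
    and less: "d < d'" and size: "d + d' = mult_size A \<mu>"
    and up: "H \<in> A \<Longrightarrow> Delta A a (\<mu>(H := Suc (\<mu> H))) \<le> Delta A a \<mu>"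
    and down: "H \<in> A \<Longrightarrow> Delta A a (\<mu>(H := \<mu> H - 1)) \<le> Delta A a \<mu>"
begin

lemma Delta_\<mu>: "Delta A a \<mu> = d' - d"
  using basis hom less by (intro Delta_eq) (unfold basis_degrees_iff, blast+, simp)

lemma \<theta>_nonzero: "\<theta> \<noteq> 0"
  using der_basis_nonzero[OF basis] by blast

lemma \<theta>_dvd: "H \<in> A \<Longrightarrow> a H ^ \<mu> H dvd der_apply \<theta> (a H)"
  using der_basis_mem[OF basis] by (simp add: D_iff)

text \<open>Otherwise \<open>\<theta>\<close> lies in a module whose multiplicity has size one
  larger, and its unchanged degree \<open>d\<close> would force \<open>Delta\<close> at the upper
  neighbour to be at least \<open>Delta A a \<mu> + 1\<close>.\<close>

lemma \<theta>_sharp: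
  assumes "H \<in> A"
  shows "\<not> a H ^ Suc (\<mu> H) dvd der_apply \<theta> (a H)"
proof
  assume "a H ^ Suc (\<mu> H) dvd der_apply \<theta> (a H)"
  then have "\<theta> \<in> D (\<mu>(H := Suc (\<mu> H)))"
    using der_basis_mem[OF basis] by (simp add: D_fun_upd_Suc[OF assms])
  from Delta_lower_bound[OF this hom(1) \<theta>_nonzero] show False
    using up[OF assms] mult_size_upd[OF assms, of \<mu> "Suc (\<mu> H)"] size less by (simp add: Delta_\<mu>)
qed

text \<open>The quotient \<open>\<eta>\<close> has degree \<open>d - 1\<close> and lies in the
  module of the lower neighbour. The size drops by at most 1 while twice the degree drops by 2, so
  \<open>Delta\<close> would increase.\<close>

lemma \<theta>_not_multiple:
  assumes "H \<in> A"
  shows "\<theta> \<noteq> der_scale (a H) \<eta>"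
proof
  assume \<eta>: "\<theta> = der_scale (a H) \<eta>"
  have "\<eta> \<noteq> 0"
    using \<theta>_nonzero \<eta> by auto
  then have deg: "1 \<le> d" "homogeneous_der (d - 1) \<eta>"
    using homogeneous_der_factor[OF homogeneous_a[OF assms] a_nonzero[OF assms]] hom(1) \<eta> by metis+
  have "a H' ^ (\<mu>(H := \<mu> H - 1)) H' dvd der_apply \<eta> (a H')" if "H' \<in> A" for H'
  proof (cases "H' = H")
    case True
    show ?thesis
    proof (cases "\<mu> H")
      case (Suc n)
      have "a H * a H ^ n dvd a H * der_apply \<eta> (a H)"
        using \<theta>_dvd[OF assms] by (simp add: \<eta> der_apply_scale Suc)
      then show ?thesis
        using True Suc a_nonzero[OF assms] by simp
    qed (simp add: True)
  next
    case False
    have "a H' ^ \<mu> H' dvd a H * der_apply \<eta> (a H')"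
      using \<theta>_dvd[OF that] by (simp add: \<eta> der_apply_scale)
    then show ?thesis
      using prime_elem_power_dvd_mult[OF prime[OF that] not_dvd[OF that assms False]] False by simp
  qed
  then have "\<eta> \<in> D (\<mu>(H := \<mu> H - 1))"
    by (simp only: D_iff) blast
  from Delta_lower_bound[OF this deg(2) \<open>\<eta> \<noteq> 0\<close>] show False
    using down[OF assms] mult_size_upd[OF assms, of \<mu> "\<mu> H - 1"] size less deg(1)
    by (simp add: Delta_\<mu>)
qed

lemma \<theta>_primitive:
  assumes "\<theta> = der_scale g \<tau>"
  shows "is_unit g"
proof -
  have "\<not> a H dvd g" if "H \<in> A" for H
  proof
    assume "a H dvd g"
    then obtain h where "g = a H * h" by (elim dvdE)
    then have "\<theta> = der_scale (a H) (der_scale h \<tau>)"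
      using assms by simp
    then show False
      using \<theta>_not_multiple[OF that] by blast
  qed
  \<comment> \<open>Since \<open>g\<close> is prime to every form, the conditions satisfied by
    \<open>\<theta>\<close> pass to \<open>\<tau>\<close>.\<close>
  then have "a H ^ \<mu> H dvd der_apply \<tau> (a H)" if "H \<in> A" for H
    using \<theta>_dvd[OF that] prime_elem_power_dvd_mult[OF prime[OF that]] that
    unfolding assms der_apply_scale by blast
  then have "\<tau> \<in> D \<mu>"
    by (simp add: D_iff)
  then obtain p q where pq: "\<tau> = der_scale p \<theta> + der_scale q \<theta>'"
    by (rule der_basis_obtain[OF basis])
  have "der_scale 1 \<theta> + der_scale 0 \<theta>' = der_scale (g * p) \<theta> + der_scale (g * q) \<theta>'"
    using assms by (simp add: pq der.scale_right_distrib)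
  then have "1 = g * p"
    by (rule der_basis_independent[OF basis])
  then show ?thesis ..
qed

text \<open>The factor f of the overview: truncated subtraction gives exponent 0 at every
  \<open>H\<close> with \<open>\<nu> H \<le> \<mu> H\<close>.\<close>

definition excess :: "('h \<Rightarrow> nat) \<Rightarrow> 'k poly poly" where
  "excess \<nu> = (\<Prod>H\<in>A. a H ^ (\<nu> H - \<mu> H))"

definition excess_degree :: "('h \<Rightarrow> nat) \<Rightarrow> nat" where
  "excess_degree \<nu> = d + (\<Sum>H\<in>A. \<nu> H - \<mu> H)"

lemma excess_nonzero: "excess \<nu> \<noteq> 0"
  using finite_A a_nonzero by (simp add: excess_def)

lemma excess_scale_in_D: "der_scale (excess \<nu>) \<theta> \<in> D \<nu>"
proof -
  have "a H ^ \<nu> H dvd excess \<nu> * der_apply \<theta> (a H)" if "H \<in> A" for H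
  proof -
    have "a H ^ (\<nu> H - \<mu> H) * a H ^ \<mu> H dvd excess \<nu> * der_apply \<theta> (a H)"
      using \<theta>_dvd[OF that] unfolding excess_def prod_power_split[OF that] by (intro mult_dvd_mono) auto
    then show ?thesis
      by (rule power_le_dvd[OF _ , of _ "\<nu> H - \<mu> H + \<mu> H", unfolded power_add]) simp
  qed
  then show ?thesis
    by (simp add: D_iff der_apply_scale)
qed

lemma homogeneous_excess_scale: "homogeneous_der (excess_degree \<nu>) (der_scale (excess \<nu>) \<theta>)"
proof -
  have "homogeneous_poly (\<Sum>H\<in>A. 1 * (\<nu> H - \<mu> H)) (excess \<nu>)"
    unfolding excess_def using finite_A homogeneous_a
    by (intro homogeneous_poly_prod homogeneous_poly_power)
  from homogeneous_der_scale[OF this hom(1)] show ?thesis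
    by (simp add: excess_degree_def add.commute)
qed

lemma excess_scale_nonzero: "der_scale (excess \<nu>) \<theta> \<noteq> 0"
  using der_scale_cancel[of "excess \<nu>" \<theta> 0] excess_nonzero \<theta>_nonzero by simp

text \<open>Pointwise, twice the positive part of \<nu> - \<mu>, plus \<mu>, equals \<nu> + |\<mu> -
  \<nu>|. Consequently, if the multiple of \<open>\<theta>\<close> by \<open>excess \<nu>\<close>
  were the smaller generator at \<open>\<nu>\<close>, \<open>Delta\<close> there would be exactly
  \<open>Delta\<close> at \<open>\<mu>\<close> minus the distance.\<close>

lemma excess_degree_eq: "2 * excess_degree \<nu> + Delta A a \<mu> = mult_size A \<nu> + mult_dist A \<mu> \<nu>"
proof -
  have "2 * (\<Sum>H\<in>A. \<nu> H - \<mu> H) + mult_size A \<mu> = mult_size A \<nu> + mult_dist A \<mu> \<nu>"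
    unfolding mult_size_def mult_dist_def sum_distrib_left sum.distrib[symmetric]
    by (intro sum.cong) auto
  then show ?thesis
    using size less by (simp add: excess_degree_def Delta_\<mu>)
qed

lemma Delta_lower: "Delta A a \<mu> \<le> Delta A a \<nu> + mult_dist A \<mu> \<nu>"
  using Delta_lower_bound[OF excess_scale_in_D homogeneous_excess_scale excess_scale_nonzero, of \<nu>]
    excess_degree_eq[of \<nu>] by simp

text \<open>A factor of \<open>excess \<nu>\<close> cannot be split off a multiple of a generator, since \<open>\<theta>\<close> is sharp.\<close>

lemma not_dvd_cofactor:
  assumes H: "H \<in> A" "\<nu> H > \<mu> H" and \<tau>: "\<tau> \<in> D \<nu>" and eq: "der_scale (excess \<nu>) \<theta> = der_scale g \<tau>"
  shows "\<not> a H dvd g"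
proof
  assume "a H dvd g"
  then obtain h where h: "g = a H * h" by (elim dvdE)
  \<comment> \<open>\<open>k\<close> is the exponent of \<open>a H\<close> left in
    \<open>excess \<nu>\<close> after one factor is cancelled against \<open>g\<close>. As
    \<open>\<nu> H = k + Suc (\<mu> H)\<close>, membership in \<open>D \<nu>\<close> then asks one
    power too many of \<open>\<theta>\<close>.\<close>
  define k where "k = \<nu> H - Suc (\<mu> H)"
  define R where "R = (\<Prod>H'\<in>A - {H}. a H' ^ (\<nu> H' - \<mu> H'))"
  have "excess \<nu> = a H ^ Suc k * R"
    unfolding excess_def prod_power_split[OF H(1)] R_def using H(2) by (simp add: k_def Suc_diff_Suc)
  then have "der_scale (a H) (der_scale (a H ^ k * R) \<theta>) = der_scale (a H) (der_scale h \<tau>)"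
    using eq by (simp add: h mult.assoc)
  then have "der_scale (a H ^ k * R) \<theta> = der_scale h \<tau>"
    using a_nonzero[OF H(1)] by (simp only: der_scale_cancel simp_thms)
  then have "der_scale (a H ^ k * R) \<theta> \<in> D \<nu>"
    using D_scale[OF \<tau>] by simp
  then have "a H ^ \<nu> H dvd a H ^ k * R * der_apply \<theta> (a H)"
    using H(1) by (simp add: D_iff der_apply_scale)
  moreover have "\<nu> H = k + Suc (\<mu> H)"
    using H(2) by (simp add: k_def)
  then have "a H ^ \<nu> H = a H ^ k * a H ^ Suc (\<mu> H)"
    by (metis power_add)
  ultimately have "a H ^ k * a H ^ Suc (\<mu> H) dvd a H ^ k * (R * der_apply \<theta> (a H))"
    by (simp only: mult.assoc)
  then have "a H ^ Suc (\<mu> H) dvd R * der_apply \<theta> (a H)"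
    using a_nonzero[OF H(1)] by (simp only: dvd_mult_cancel_left power_not_zero simp_thms)
  moreover have "\<not> a H dvd R"
    unfolding R_def by (intro not_dvd_prod[OF H(1)]) simp
  ultimately show False
    using prime_elem_power_dvd_mult[OF prime[OF H(1)]] \<theta>_sharp[OF H(1)] by blast
qed

lemma Delta_eq_diff_dist:
  assumes "Delta A a \<nu> > 0" "mult_dist A \<mu> \<nu> \<le> Delta A a \<mu>"
  shows "Delta A a \<nu> + mult_dist A \<mu> \<nu> = Delta A a \<mu>"
proof -
  obtain e1 e2 where e: "basis_degrees A a \<nu> e1 e2" "e1 \<le> e2" "e1 + e2 = mult_size A \<nu>"
    "Delta A a \<nu> = e2 - e1"
    by (rule exponents)
  obtain \<tau> \<tau>' where \<tau>: "der_basis (D \<nu>) \<tau> \<tau>'" "homogeneous_der e1 \<tau>" "homogeneous_der e2 \<tau>'"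
    using e(1) unfolding basis_degrees_iff by blast
  \<comment> \<open>The distance bound gives 2 * \<open>excess_degree \<nu>\<close> \<le> e1 + e2,
    and positivity of \<open>Delta\<close> at \<open>\<nu>\<close> makes this smaller than 2 *
    e2.\<close>
  have "excess_degree \<nu> < e2"
    using excess_degree_eq[of \<nu>] e assms by linarith
  then obtain g where g: "e1 \<le> excess_degree \<nu>" "homogeneous_poly (excess_degree \<nu> - e1) g"
    "der_scale (excess \<nu>) \<theta> = der_scale g \<tau>"
    using der_basis_homogeneous_element[OF \<tau> excess_scale_in_D homogeneous_excess_scale excess_scale_nonzero]
    by blast
  have *: "H \<in> A \<Longrightarrow> \<nu> H - \<mu> H > 0 \<Longrightarrow> prime_elem (a H) \<and> \<not> a H dvd g" for H
    using not_dvd_cofactor[OF _ _ der_basis_mem(1)[OF \<tau>(1)] g(3)] prime by simp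
  have "excess \<nu> dvd x" if "excess \<nu> dvd g * x" for x
    using prime_elem_prod_power_dvd_mult[where f = a and k = "\<lambda>H. \<nu> H - \<mu> H",
      OF finite_A * that[unfolded excess_def]] unfolding excess_def .
  moreover have "excess \<nu> dvd g * fst \<tau>" "excess \<nu> dvd g * snd \<tau>"
    using g(3) by (metis der_scale_def dvd_triv_left fst_conv snd_conv)+
  ultimately have "excess \<nu> dvd fst \<tau>" "excess \<nu> dvd snd \<tau>"
    by blast+
  \<comment> \<open>Dividing \<open>\<tau>\<close> by \<open>excess \<nu>\<close> exhibits
    \<open>\<theta>\<close> as \<open>g\<close> times \<open>\<sigma>\<close>. Primitivity then
    makes \<open>g\<close> a unit, whose degree \<open>excess_degree \<nu> - e1\<close> must be
    0.\<close>
  then obtain \<sigma> where \<sigma>: "\<tau> = der_scale (excess \<nu>) \<sigma>"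
    by (rule der_scale_dvdE)
  have "der_scale (excess \<nu>) \<theta> = der_scale (excess \<nu>) (der_scale g \<sigma>)"
    using g(3) by (simp add: \<sigma> mult.commute)
  then have "\<theta> = der_scale g \<sigma>"
    using excess_nonzero by (simp only: der_scale_cancel simp_thms)
  then have "excess_degree \<nu> - e1 = 0"
    using homogeneous_poly_is_unit[OF g(2)] \<theta>_primitive by blast
  then show ?thesis
    using g(1) excess_degree_eq[of \<nu>] e(2-4) by simp
qed

end

section \<open>Distance and connectivity in the Hasse graph\<close>

lemma mult_dist_commute: "mult_dist A \<mu> \<nu> = mult_dist A \<nu> \<mu>"
  unfolding mult_dist_def by (simp add: abs_minus_commute)

lemma mult_dist_triangle: "mult_dist A \<mu> \<nu> \<le> mult_dist A \<mu> \<kappa> + mult_dist A \<kappa> \<nu>"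
  unfolding mult_dist_def sum.distrib[symmetric] by (intro sum_mono) auto

lemma mult_dist_covered:
  assumes "covered A \<mu> \<nu>"
  shows "mult_dist A \<mu> \<nu> = 1"
proof -
  have "mult_dist A \<mu> \<nu> = (\<Sum>H\<in>A. \<nu> H - \<mu> H)"
    unfolding mult_dist_def using assms by (intro sum.cong) (auto simp: covered_def)
  also have "\<dots> = mult_size A \<nu> - mult_size A \<mu>"
    unfolding mult_size_def using assms by (intro sum_subtractf_nat) (auto simp: covered_def)
  finally show ?thesis
    using assms by (simp add: covered_def)
qed

lemma mult_dist_eq_0_iff:
  assumes "finite A" "\<mu> \<in> multiplicities A" "\<nu> \<in> multiplicities A"
  shows "mult_dist A \<mu> \<nu> = 0 \<longleftrightarrow> \<mu> = \<nu>"
proof -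
  have "mult_dist A \<mu> \<nu> = 0 \<longleftrightarrow> (\<forall>H\<in>A. \<mu> H = \<nu> H)"
    using assms(1) by (auto simp: mult_dist_def)
  then show ?thesis
    using assms(2,3) unfolding multiplicities_def by (metis PiE_ext)
qed

lemma fun_upd_in_multiplicities:
  "\<mu> \<in> multiplicities A \<Longrightarrow> H \<in> A \<Longrightarrow> \<mu>(H := n) \<in> multiplicities A"
  by (auto simp: multiplicities_def PiE_iff extensional_def)

lemma covered_fun_upd_Suc:
  assumes "finite A" "H \<in> A"
  shows "covered A \<mu> (\<mu>(H := Suc (\<mu> H)))"
proof -
  have "mult_size A (\<mu>(H := Suc (\<mu> H))) = mult_size A \<mu> + 1"
    using assms by (simp add: mult_size_def sum.remove cong: sum.cong_simp)
  then show ?thesis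
    by (auto simp: covered_def)
qed

lemma sym_induced_edges: "sym (induced_edges A C)"
  by (auto simp: sym_def induced_edges_def)

lemma induced_edges_mono: "B \<subseteq> C \<Longrightarrow> induced_edges A B \<subseteq> induced_edges A C"
  by (auto simp: induced_edges_def)

lemma connected_subsetI:
  assumes "C \<subseteq> multiplicities A" "\<mu> \<in> C" "\<And>\<nu>. \<nu> \<in> C \<Longrightarrow> (\<mu>, \<nu>) \<in> (induced_edges A C)\<^sup>*"
  shows "connected_subset A C"
proof -
  have "(\<kappa>, \<nu>) \<in> (induced_edges A C)\<^sup>*" if "\<kappa> \<in> C" "\<nu> \<in> C" for \<kappa> \<nu>
    using assms(3)[OF that(1)] assms(3)[OF that(2)] sym_rtrancl[OF sym_induced_edges]
    by (metis rtrancl_trans symD)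
  then show ?thesis
    using assms(1,2) unfolding connected_subset_def by blast
qed

lemma connected_subset_Un:
  assumes "connected_subset A B" "connected_subset A C" "\<mu> \<in> B" "\<mu> \<in> C"
  shows "connected_subset A (B \<union> C)"
proof (rule connected_subsetI)
  show "B \<union> C \<subseteq> multiplicities A" "\<mu> \<in> B \<union> C"
    using assms by (auto simp: connected_subset_def)
  show "(\<mu>, \<nu>) \<in> (induced_edges A (B \<union> C))\<^sup>*" if "\<nu> \<in> B \<union> C" for \<nu>
  proof -
    have "(\<mu>, \<nu>) \<in> (induced_edges A B)\<^sup>* \<or> (\<mu>, \<nu>) \<in> (induced_edges A C)\<^sup>*"
      using that assms unfolding connected_subset_def by blast
    then show ?thesis
      using rtrancl_mono[OF induced_edges_mono] by (metis Un_upper1 Un_upper2 subsetD)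
  qed
qed

text \<open>A connected set meeting the component can be joined to it without losing connectivity,
  so maximality swallows it.\<close>

lemma connected_component_absorb:
  assumes "connected_component_of_subset A L C" "connected_subset A B" "B \<subseteq> L" "\<mu> \<in> B" "\<mu> \<in> C"
  shows "B \<subseteq> C"
proof -
  have "connected_subset A (B \<union> C)" "B \<union> C \<subseteq> L" "C \<subseteq> B \<union> C"
    using connected_subset_Un[OF assms(2) _ assms(4,5)] assms(1,3)
    by (auto simp: connected_component_of_subset_def)
  then have "B \<union> C = C"
    using assms(1) unfolding connected_component_of_subset_def by blast
  then show ?thesis by blast
qed

lemma connected_component_edge:
  assumes "connected_component_of_subset A L C" "\<mu> \<in> C" "\<nu> \<in> L" "\<nu> \<in> multiplicities A"
    and "covered A \<mu> \<nu> \<or> covered A \<nu> \<mu>"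
  shows "\<nu> \<in> C"
proof -
  have \<mu>: "\<mu> \<in> multiplicities A" "\<mu> \<in> L"
    using assms(1,2) by (auto simp: connected_component_of_subset_def connected_subset_def)
  have "(\<mu>, \<nu>) \<in> induced_edges A {\<mu>, \<nu>}"
    using assms(5) by (auto simp: induced_edges_def)
  then have "connected_subset A {\<mu>, \<nu>}"
    using \<mu>(1) assms(4) by (intro connected_subsetI[of _ _ \<mu>]) auto
  from connected_component_absorb[OF assms(1) this] show ?thesis
    using assms(2,3) \<mu>(2) by blast
qed

lemma connected_mult_ball:
  assumes "finite A" "\<mu> \<in> multiplicities A" "r > 0"
  shows "connected_subset A (mult_ball A \<mu> r)"
proof (rule connected_subsetI)
  show "mult_ball A \<mu> r \<subseteq> multiplicities A"
    by (auto simp: mult_ball_def)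
  show "\<mu> \<in> mult_ball A \<mu> r"
    using assms mult_dist_eq_0_iff[of A \<mu> \<mu>] by (simp add: mult_ball_def)
  show "(\<mu>, \<nu>) \<in> (induced_edges A (mult_ball A \<mu> r))\<^sup>*" if "\<nu> \<in> mult_ball A \<mu> r" for \<nu>
    using that
  proof (induction "mult_dist A \<mu> \<nu>" arbitrary: \<nu>)
    case 0
    then show ?case
      using mult_dist_eq_0_iff[OF assms(1,2), of \<nu>] by (simp add: mult_ball_def)
  next
    case (Suc n)
    then have \<nu>: "\<nu> \<in> multiplicities A" "Suc n < r"
      by (auto simp: mult_ball_def)
    obtain H where H: "H \<in> A" "\<mu> H \<noteq> \<nu> H"
      using Suc.hyps(2) mult_dist_eq_0_iff[OF assms(1,2) \<nu>(1)] assms(2) \<nu>(1)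
      unfolding multiplicities_def by (metis PiE_ext nat.distinct(1))
    \<comment> \<open>One coordinate in which \<open>\<nu>\<close> differs from the centre is moved
      one step towards it. This lowers the distance by exactly 1, so the path to the centre stays
      inside the ball.\<close>
    define \<nu>' where "\<nu>' = \<nu>(H := if \<nu> H < \<mu> H then Suc (\<nu> H) else \<nu> H - 1)"
    have "mult_dist A \<mu> \<nu> = nat \<bar>int (\<mu> H) - int (\<nu> H)\<bar> + (\<Sum>H\<in>A - {H}. nat \<bar>int (\<mu> H) - int (\<nu> H)\<bar>)"
      using assms(1) H(1) by (simp add: mult_dist_def sum.remove)
    also have "nat \<bar>int (\<mu> H) - int (\<nu> H)\<bar> = Suc (nat \<bar>int (\<mu> H) - int (\<nu>' H)\<bar>)"
      using H(2) by (auto simp: \<nu>'_def)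
    also have "(\<Sum>H\<in>A - {H}. nat \<bar>int (\<mu> H) - int (\<nu> H)\<bar>) =
        (\<Sum>H\<in>A - {H}. nat \<bar>int (\<mu> H) - int (\<nu>' H)\<bar>)"
      by (intro sum.cong) (auto simp: \<nu>'_def)
    finally have dist: "n = mult_dist A \<mu> \<nu>'"
      using assms(1) H(1) Suc.hyps(2) by (simp add: mult_dist_def sum.remove)
    have \<nu>': "\<nu>' \<in> mult_ball A \<mu> r"
      using \<nu> H(1) dist by (simp add: mult_ball_def \<nu>'_def fun_upd_in_multiplicities)
    have "covered A \<nu> \<nu>' \<or> covered A \<nu>' \<nu>"
    proof (cases "\<nu> H < \<mu> H")
      case True
      then show ?thesis
        using covered_fun_upd_Suc[OF assms(1) H(1), of \<nu>] by (simp add: \<nu>'_def)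
    next
      case False
      then have "\<nu>'(H := Suc (\<nu>' H)) = \<nu>"
        using H(2) by (auto simp: \<nu>'_def)
      then show ?thesis
        using covered_fun_upd_Suc[OF assms(1) H(1), of \<nu>'] by simp
    qed
    then have "(\<nu>', \<nu>) \<in> induced_edges A (mult_ball A \<mu> r)"
      using \<nu>' Suc.prems by (auto simp: induced_edges_def)
    then show ?case
      using Suc.hyps(1)[OF dist \<nu>'] by (rule rtrancl_into_rtrancl[rotated])
  qed
qed

section \<open>Finite components are balls\<close>

context line_arrangement
begin

lemma finite_component_is_ball:
  assumes comp: "connected_component_of_subset A (Lambda' A a) C" and "finite C" and "\<mu> \<in> C"
    and max: "Delta A a \<mu> = Max (Delta A a ` C)"
  shows "C = mult_ball A \<mu> (Delta A a \<mu>)"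
    and "\<And>\<nu>. \<nu> \<in> C \<Longrightarrow> Delta A a \<nu> + mult_dist A \<mu> \<nu> = Delta A a \<mu>"
proof -
  have C: "C \<subseteq> Lambda' A a" "connected_subset A C"
    using comp by (auto simp: connected_component_of_subset_def)
  have \<mu>: "\<mu> \<in> multiplicities A" "Delta A a \<mu> > 0"
    using C(1) \<open>\<mu> \<in> C\<close> by (auto simp: Lambda'_def)
  have le: "Delta A a \<nu> \<le> Delta A a \<mu>"
    if "\<nu> \<in> multiplicities A" "covered A \<mu> \<nu> \<or> covered A \<nu> \<mu>" for \<nu>
  \<comment> \<open>A neighbour of \<open>\<mu>\<close> is either outside \<Lambda>', with
    \<open>Delta\<close> equal to 0, or belongs to the component and is bounded by its
    maximum.\<close>
  proof (cases "Delta A a \<nu> = 0")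
    case False
    then have "\<nu> \<in> C"
      using connected_component_edge[OF comp \<open>\<mu> \<in> C\<close> _ that] that(1) by (simp add: Lambda'_def)
    then show ?thesis
      unfolding max using \<open>finite C\<close> by simp
  qed simp
  obtain d d' where d: "basis_degrees A a \<mu> d d'" "d \<le> d'" "d + d' = mult_size A \<mu>"
    "Delta A a \<mu> = d' - d"
    by (rule exponents)
  then obtain \<theta> \<theta>' where \<theta>: "der_basis (D \<mu>) \<theta> \<theta>'" "homogeneous_der d \<theta>" "homogeneous_der d' \<theta>'"
    unfolding basis_degrees_iff by blast
  interpret local_maximum A a b c \<mu> \<theta> \<theta>' d d'
  proof
    show "d < d'"
      using d(4) \<mu>(2) by simp
  next
    fix H assume H: "H \<in> A"
    show "Delta A a (\<mu>(H := Suc (\<mu> H))) \<le> Delta A a \<mu>"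
      using covered_fun_upd_Suc[OF finite_A H] fun_upd_in_multiplicities[OF \<mu>(1) H] le by blast
    show "Delta A a (\<mu>(H := \<mu> H - 1)) \<le> Delta A a \<mu>"
    proof (cases "\<mu> H = 0")
      case True
      then have "\<mu>(H := \<mu> H - 1) = \<mu>"
        by auto
      then show ?thesis by simp
    next
      case False
      then have "covered A (\<mu>(H := \<mu> H - 1)) \<mu>"
        using covered_fun_upd_Suc[OF finite_A H, of "\<mu>(H := \<mu> H - 1)"] by simp
      then show ?thesis
        using fun_upd_in_multiplicities[OF \<mu>(1) H] le by blast
    qed
  qed (use \<theta> d in auto)
  let ?B = "mult_ball A \<mu> (Delta A a \<mu>)"
  have "?B \<subseteq> Lambda' A a"
  proof
    show "\<nu> \<in> Lambda' A a" if "\<nu> \<in> ?B" for \<nu>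
      using that Delta_lower[of \<nu>] by (simp add: mult_ball_def Lambda'_def)
  qed
  moreover have \<mu>_B: "\<mu> \<in> ?B"
    using \<mu> mult_dist_eq_0_iff[OF finite_A \<mu>(1) \<mu>(1)] by (simp add: mult_ball_def)
  ultimately have "?B \<subseteq> C"
    using connected_component_absorb[OF comp connected_mult_ball[OF finite_A \<mu>]] \<open>\<mu> \<in> C\<close> by blast
  \<comment> \<open>Along a path in \<open>C\<close> starting at \<open>\<mu>\<close>, the next
    vertex has distance at most \<open>Delta A a \<mu>\<close> and positive \<open>Delta\<close>.
    The equality \<open>Delta_eq_diff_dist\<close> then makes the distance strictly smaller, so the
    path never leaves the ball.\<close>
  have "\<nu> \<in> ?B" if "\<nu> \<in> C" for \<nu>
  proof -
    have "(\<mu>, \<nu>) \<in> (induced_edges A C)\<^sup>*"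
      using C(2) \<open>\<mu> \<in> C\<close> that unfolding connected_subset_def by blast
    then show ?thesis
    proof (induction rule: rtrancl_induct)
      case (step \<kappa> \<nu>)
      then have edge: "\<nu> \<in> C" "covered A \<kappa> \<nu> \<or> covered A \<nu> \<kappa>"
        by (auto simp: induced_edges_def)
      then have "mult_dist A \<kappa> \<nu> = 1"
        using mult_dist_covered mult_dist_commute by metis
      then have "mult_dist A \<mu> \<nu> \<le> Delta A a \<mu>"
        using step.IH mult_dist_triangle[of A \<mu> \<nu> \<kappa>] by (simp add: mult_ball_def)
      moreover have "\<nu> \<in> multiplicities A" "Delta A a \<nu> > 0"
        using edge C(1) by (auto simp: Lambda'_def)
      ultimately show ?case
        using Delta_eq_diff_dist[of \<nu>] by (simp add: mult_ball_def)
    qed (rule \<mu>_B)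
  qed
  with \<open>?B \<subseteq> C\<close> show *: "C = ?B"
    by blast
  show "Delta A a \<nu> + mult_dist A \<mu> \<nu> = Delta A a \<mu>" if "\<nu> \<in> C" for \<nu>
  proof (rule Delta_eq_diff_dist)
    show "Delta A a \<nu> > 0"
      using that C(1) by (auto simp: Lambda'_def)
    show "mult_dist A \<mu> \<nu> \<le> Delta A a \<mu>"
      using that unfolding * by (simp add: mult_ball_def)
  qed
qed

end

section \<open>Passage from the plane V to coordinates\<close>

lemma linear_form_poly_eq: "linear_form_poly e1 e2 f = linear_poly (f e1) (f e2)"
  by (simp add: linear_form_poly_def linear_poly_def varX_def varY_def)

theorem theorem3p2:
  fixes scale :: "'k::field \<Rightarrow> 'v::ab_group_add \<Rightarrow> 'v"
    and e1 e2 :: 'v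
    and A :: "'v set set"
    and \<alpha> :: "'v set \<Rightarrow> 'v \<Rightarrow> 'k"
    and a :: "'v set \<Rightarrow> 'k poly poly"
    and C :: "('v set \<Rightarrow> nat) set"
    and \<mu> :: "'v set \<Rightarrow> nat"
  assumes "vector_space scale"
    and "vector_space.dim scale UNIV = 2"
    and "e1 \<noteq> e2"
    and "\<not> module.dependent scale {e1, e2}"
    and "module.span scale {e1, e2} = UNIV"
    and "finite A"
    and "\<And>H. H \<in> A \<Longrightarrow> module.subspace scale H \<and> vector_space.dim scale H = 1"
    and "\<And>H. H \<in> A \<Longrightarrow> Vector_Spaces.linear scale (*) (\<alpha> H)"
    and "\<And>H. H \<in> A \<Longrightarrow> {v. \<alpha> H v = 0} = H"
    and "\<And>H. H \<in> A \<Longrightarrow> a H = linear_form_poly e1 e2 (\<alpha> H)"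
    and "connected_component_of_subset A (Lambda' A a) C"
    and "finite C"
    and "\<mu> \<in> C"
    and "Delta A a \<mu> = Max (Delta A a ` C)"
  shows "C = mult_ball A \<mu> (Delta A a \<mu>)
    \<and> (\<forall>\<nu>\<in>C. int (Delta A a \<nu>) = int (Delta A a \<mu>) - int (mult_dist A \<mu> \<nu>))
    \<and> (\<exists>!\<kappa>. \<kappa> \<in> C \<and> Delta A a \<kappa> = Max (Delta A a ` C))"
proof -
  interpret V: vector_space scale by fact
  \<comment> \<open>\<open>x\<close> and \<open>y\<close> are the coordinates of \<open>v\<close> in
    the basis \<open>e1\<close>, \<open>e2\<close>, so the same pair serves all forms at
    once.\<close>
  have expand: "\<exists>x y. \<forall>H\<in>A. \<alpha> H v = x * \<alpha> H e1 + y * \<alpha> H e2" for v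
  proof -
    have "v \<in> V.span {e1, e2}"
      using assms(5) by simp
    then obtain x y where "v - scale x e1 = scale y e2"
      by (auto simp: V.span_insert V.span_singleton)
    then have v: "v = scale x e1 + scale y e2"
      by (simp add: algebra_simps)
    have "\<alpha> H v = x * \<alpha> H e1 + y * \<alpha> H e2" if "H \<in> A" for H
    proof -
      interpret Vector_Spaces.linear scale "(*)" "\<alpha> H"
        using assms(8)[OF that] .
      show ?thesis
        unfolding v by (simp add: add scale)
    qed
    then show ?thesis
      by blast
  qed
  interpret line_arrangement A a "\<lambda>H. \<alpha> H e1" "\<lambda>H. \<alpha> H e2"
  proof
    show nonzero: "\<alpha> H e1 \<noteq> 0 \<or> \<alpha> H e2 \<noteq> 0" if "H \<in> A" for H
    proof (rule ccontr)
      assume "\<not> (\<alpha> H e1 \<noteq> 0 \<or> \<alpha> H e2 \<noteq> 0)"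
      \<comment> \<open>A form vanishing on the basis has the whole plane as kernel, of dimension 2
        and not 1.\<close>
      then have "\<alpha> H v = 0" for v
        using expand[of v] that by auto
      then have "H = UNIV"
        using assms(9)[OF that] by blast
      then show False
        using assms(2) assms(7)[OF that] by simp
    qed
    show "\<alpha> H e1 * \<alpha> H' e2 \<noteq> \<alpha> H' e1 * \<alpha> H e2" if "H \<in> A" "H' \<in> A" "H \<noteq> H'" for H H'
    proof
      assume eq: "\<alpha> H e1 * \<alpha> H' e2 = \<alpha> H' e1 * \<alpha> H e2"
      \<comment> \<open>A vanishing determinant makes the two forms proportional; as
        \<open>t\<close> is nonzero, their kernels \<open>H\<close> and \<open>H'\<close>
        coincide.\<close>
      obtain t where t: "t \<noteq> 0" "\<alpha> H' e1 = t * \<alpha> H e1" "\<alpha> H' e2 = t * \<alpha> H e2"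
      proof (cases "\<alpha> H e1 = 0")
        case True
        then have "\<alpha> H e2 \<noteq> 0" "\<alpha> H' e1 = 0"
          using eq nonzero[OF \<open>H \<in> A\<close>] by auto
        then show ?thesis
          using that[of "\<alpha> H' e2 / \<alpha> H e2"] True nonzero[OF \<open>H' \<in> A\<close>] by simp
      next
        case False
        then have c: "\<alpha> H' e2 = \<alpha> H' e1 / \<alpha> H e1 * \<alpha> H e2"
          using eq by (simp add: field_simps)
        then have "\<alpha> H' e1 \<noteq> 0"
          using nonzero[OF \<open>H' \<in> A\<close>] by auto
        then show ?thesis
          using that[of "\<alpha> H' e1 / \<alpha> H e1"] False c by simp
      qed
      have "\<alpha> H' v = t * \<alpha> H v" for v
      proof -
        obtain x y where xy: "\<forall>H\<in>A. \<alpha> H v = x * \<alpha> H e1 + y * \<alpha> H e2"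
          using expand by blast
        have "\<alpha> H' v = x * \<alpha> H' e1 + y * \<alpha> H' e2" "\<alpha> H v = x * \<alpha> H e1 + y * \<alpha> H e2"
          using xy that(1,2) by blast+
        then show ?thesis
          unfolding t(2,3) by (simp only: distrib_left mult.left_commute)
      qed
      then have "{v. \<alpha> H' v = 0} = {v. \<alpha> H v = 0}"
        using t(1) by auto
      then show False
        unfolding assms(9)[OF that(1)] assms(9)[OF that(2)] using that(3) by blast
    qed
  qed (use assms(6,10) in \<open>simp_all add: linear_form_poly_eq\<close>)
  note ball = finite_component_is_ball[OF assms(11-14)]
  have mult: "\<kappa> \<in> multiplicities A" if "\<kappa> \<in> C" for \<kappa>
    using that assms(11) by (auto simp: connected_component_of_subset_def connected_subset_def)
  have "\<kappa> = \<mu>" if "\<kappa> \<in> C" "Delta A a \<kappa> = Max (Delta A a ` C)" for \<kappa>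
  proof -
    have "mult_dist A \<mu> \<kappa> = 0"
      using ball(2)[OF that(1)] that(2) assms(14) by simp
    then show ?thesis
      using mult_dist_eq_0_iff[OF assms(6) mult[OF assms(13)] mult[OF that(1)]] by simp
  qed
  then have "\<exists>!\<kappa>. \<kappa> \<in> C \<and> Delta A a \<kappa> = Max (Delta A a ` C)"
    using assms(13,14) by (intro ex1I[of _ \<mu>] conjI) blast+
  moreover have "\<forall>\<nu>\<in>C. int (Delta A a \<nu>) = int (Delta A a \<mu>) - int (mult_dist A \<mu> \<nu>)"
  proof
    show "int (Delta A a \<nu>) = int (Delta A a \<mu>) - int (mult_dist A \<mu> \<nu>)" if "\<nu> \<in> C" for \<nu>
      using ball(2)[OF that] by linarith
  qed
  ultimately show ?thesis
    by (intro conjI ball(1))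
qed

end
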